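(* Let $L$ be a finite simple connected graph with minimal valency one or two. Then $L$ is star-transitive and st(edge)-transitive if and only if one of the following holds: (1) $L$ is a complete bipartite graph $K_{1,n}$ for some $n\ge 1$; (2) $L$ is a cycle of length $n$ for some $n\ge 3$; or (3) there exists a locally fully symmetric, arc-transitive graph $\Sigma$ of valency at least three such that $L$ can be obtained by subdividing each edge of $\Sigma$ with a new vertex of valency two.
   Context: All graphs are finite. A graph $\Sigma$ is arc-transitive if $\operatorname{Aut}(\Sigma)$ is transitive on arcs (directed edges), and locally fully symmetric if for each vertex $v$ the stabiliser of $v$ in $\operatorname{Aut}(\Sigma)$ induces the full symmetric group on the set of neighbours of $v$. Open stars. For a vertex $v$, $\operatorname{st}(v)$ is the union of $\{v\}$ and the set of edges incident to $v$. For an edge $\{u,v\}$, $\operatorname{st}(\{u,v\})$ is the union of $\{u\}$, $\{v\}$ and the set of all edges incident to at least one of $u,v$. A star isomorphism $\varphi:\operatorname{st}(v_1)\to\operatorname{st}(v_2)$ is a bijection with $\varphi(v_1)=v_2$. An edge-star isomorphism $\varphi:\operatorname{st}(\{u_1,v_1\})\to\operatorname{st}(\{u_2,v_2\})$ is a bijection that maps the vertices $u_1,v_1$ (in some order) to the vertices $u_2,v_2$ and is incidence-preserving: an edge $f\in\operatorname{st}(\{u_1,v_1\})$ is incident to $u_1$ iff $\varphi(f)$ is incident to $\varphi(u_1)$, and incident to $v_1$ iff $\varphi(f)$ is incident to $\varphi(v_1)$. (Adjacencies among the neighbours are not required to be preserved.) A simple graph $L$ is star-transitive if for all vertices $v_1,v_2$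 and every star isomorphism $\varphi:\operatorname{st}(v_1)\to\operatorname{st}(v_2)$ there is $\psi\in \operatorname{Aut}(L)$ with $\psi(v_1)=\varphi(v_1)$ and $\psi(f)=\varphi(f)$ for every edge $f\in\operatorname{st}(v_1)$. $L$ is st(edge)-transitive if for all edges $\{u_1,v_1\},\{u_2,v_2\}$ and every edge-star isomorphism $\varphi:\operatorname{st}(\{u_1,v_1\})\to\operatorname{st}(\{u_2,v_2\})$ there is $\psi\in \operatorname{Aut}(L)$ with $\psi(u_1)=\varphi(u_1)$, $\psi(v_1)=\varphi(v_1)$ and $\psi(f)=\varphi(f)$ for every edge $f\in\operatorname{st}(\{u_1,v_1\})$.
   Formalization: In (3) Σ may have parallel edges, and locally fully symmetric means the full symmetric group on the edges at each vertex (for simple Σ, on the neighbours); otherwise K_{2,n}, n ≥ 3 (if Σ is simple), or the subdivided doubled triangle (if only neighbours are permuted) is a counterexample. *)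

theory Defs
  imports Main "HOL-Combinatorics.Permutations"
begin

text \<open>
  Edges are objects of their own, attached to vertices by an incidence map, so that parallel
  edges are possible; simplicity is a separate predicate.  Loops are excluded: the subdivision
  of a loop is a pair of parallel edges, so a graph with loops never has a simple subdivision.
\<close>

record ('v, 'e) graph =
  verts :: "'v set"
  edges :: "'e set"
  ends :: "'e \<Rightarrow> 'v set"

definition finite_graph :: "('v, 'e) graph \<Rightarrow> bool" where
  "finite_graph G \<longleftrightarrow> finite (verts G) \<and> finite (edges G) \<and>
     (\<forall>e\<in>edges G. ends G e \<subseteq> verts G \<and> card (ends G e) = 2)"

definition simple_graph :: "('v, 'e) graph \<Rightarrow> bool" where
  "simple_graph G \<longleftrightarrow> inj_on (ends G) (edges G)"

definition adjacent :: "('v, 'e) graph \<Rightarrow> 'v \<Rightarrow> 'v \<Rightarrow> bool" where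
  "adjacent G u v \<longleftrightarrow> (\<exists>e\<in>edges G. ends G e = {u, v})"

definition connected_graph :: "('v, 'e) graph \<Rightarrow> bool" where
  "connected_graph G \<longleftrightarrow> verts G \<noteq> {} \<and> (\<forall>u\<in>verts G. \<forall>v\<in>verts G. (adjacent G)\<^sup>*\<^sup>* u v)"

definition incident_edges :: "('v, 'e) graph \<Rightarrow> 'v \<Rightarrow> 'e set" where
  "incident_edges G v = {e \<in> edges G. v \<in> ends G e}"

definition valency :: "('v, 'e) graph \<Rightarrow> 'v \<Rightarrow> nat" where
  "valency G v = card (incident_edges G v)"

definition min_valency :: "('v, 'e) graph \<Rightarrow> nat" where
  "min_valency G = Min (valency G ` verts G)"

definition regular_graph :: "nat \<Rightarrow> ('v, 'e) graph \<Rightarrow> bool" where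
  "regular_graph k G \<longleftrightarrow> (\<forall>v\<in>verts G. valency G v = k)"

definition graph_iso ::
    "('v, 'e) graph \<Rightarrow> ('w, 'f) graph \<Rightarrow> ('v \<Rightarrow> 'w) \<Rightarrow> ('e \<Rightarrow> 'f) \<Rightarrow> bool" where
  "graph_iso G H f g \<longleftrightarrow> bij_betw f (verts G) (verts H) \<and> bij_betw g (edges G) (edges H) \<and>
     (\<forall>e\<in>edges G. ends H (g e) = f ` ends G e)"

definition isomorphic :: "('v, 'e) graph \<Rightarrow> ('w, 'f) graph \<Rightarrow> bool" where
  "isomorphic G H \<longleftrightarrow> (\<exists>f g. graph_iso G H f g)"

abbreviation graph_aut :: "('v, 'e) graph \<Rightarrow> ('v \<Rightarrow> 'v) \<Rightarrow> ('e \<Rightarrow> 'e) \<Rightarrow> bool" where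
  "graph_aut G \<equiv> graph_iso G G"

text \<open>The arc \<open>(v, e)\<close> is the edge \<open>e\<close> directed away from its end \<open>v\<close>.\<close>

definition arcs :: "('v, 'e) graph \<Rightarrow> ('v \<times> 'e) set" where
  "arcs G = {(v, e). e \<in> edges G \<and> v \<in> ends G e}"

definition arc_transitive :: "('v, 'e) graph \<Rightarrow> bool" where
  "arc_transitive G \<longleftrightarrow>
     (\<forall>a\<in>arcs G. \<forall>b\<in>arcs G. \<exists>f g. graph_aut G f g \<and> map_prod f g a = b)"

text \<open>
  The neighbours of \<open>v\<close> are counted with multiplicity, that is, the local action is the one on
  the edges at \<open>v\<close>.  For simple graphs this is the action on the set of neighbours, see
  \<open>locally_fully_symmetric_simple\<close> below.
\<close>

definition locally_fully_symmetric :: "('v, 'e) graph \<Rightarrow> bool" where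
  "locally_fully_symmetric G \<longleftrightarrow>
     (\<forall>v\<in>verts G. \<forall>p. p permutes incident_edges G v \<longrightarrow>
        (\<exists>f g. graph_aut G f g \<and> f v = v \<and> (\<forall>e\<in>incident_edges G v. g e = p e)))"

definition star :: "('v, 'e) graph \<Rightarrow> 'v \<Rightarrow> ('v + 'e) set" where
  "star G v = insert (Inl v) (Inr ` incident_edges G v)"

definition edge_star :: "('v, 'e) graph \<Rightarrow> 'e \<Rightarrow> ('v + 'e) set" where
  "edge_star G e = Inl ` ends G e \<union> Inr ` (\<Union>v\<in>ends G e. incident_edges G v)"

fun incident :: "('v, 'e) graph \<Rightarrow> 'v + 'e \<Rightarrow> 'v + 'e \<Rightarrow> bool" where
  "incident G (Inr e) (Inl v) \<longleftrightarrow> v \<in> ends G e"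
| "incident G _ _ \<longleftrightarrow> False"

definition star_iso :: "('v, 'e) graph \<Rightarrow> 'v \<Rightarrow> 'v \<Rightarrow> ('v + 'e \<Rightarrow> 'v + 'e) \<Rightarrow> bool" where
  "star_iso G v1 v2 \<phi> \<longleftrightarrow> bij_betw \<phi> (star G v1) (star G v2) \<and> \<phi> (Inl v1) = Inl v2"

definition edge_star_iso :: "('v, 'e) graph \<Rightarrow> 'e \<Rightarrow> 'e \<Rightarrow> ('v + 'e \<Rightarrow> 'v + 'e) \<Rightarrow> bool" where
  "edge_star_iso G e1 e2 \<phi> \<longleftrightarrow> bij_betw \<phi> (edge_star G e1) (edge_star G e2) \<and>
     \<phi> ` Inl ` ends G e1 = Inl ` ends G e2 \<and>
     (\<forall>f. Inr f \<in> edge_star G e1 \<longrightarrow>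
        (\<forall>v\<in>ends G e1. incident G (Inr f) (Inl v) \<longleftrightarrow> incident G (\<phi> (Inr f)) (\<phi> (Inl v))))"

definition star_transitive :: "('v, 'e) graph \<Rightarrow> bool" where
  "star_transitive G \<longleftrightarrow>
     (\<forall>v1\<in>verts G. \<forall>v2\<in>verts G. \<forall>\<phi>. star_iso G v1 v2 \<phi> \<longrightarrow>
        (\<exists>f g. graph_aut G f g \<and> (\<forall>x\<in>star G v1. map_sum f g x = \<phi> x)))"

definition st_edge_transitive :: "('v, 'e) graph \<Rightarrow> bool" where
  "st_edge_transitive G \<longleftrightarrow>
     (\<forall>e1\<in>edges G. \<forall>e2\<in>edges G. \<forall>\<phi>. edge_star_iso G e1 e2 \<phi> \<longrightarrow>
        (\<exists>f g. graph_aut G f g \<and> (\<forall>x\<in>edge_star G e1. map_sum f g x = \<phi> x)))"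

definition complete_bipartite :: "nat \<Rightarrow> nat \<Rightarrow> (nat + nat, nat \<times> nat) graph" where
  "complete_bipartite m n =
     \<lparr>verts = {..<m} <+> {..<n}, edges = {..<m} \<times> {..<n}, ends = (\<lambda>(i, j). {Inl i, Inr j})\<rparr>"

text \<open>Intended for \<open>n \<ge> 3\<close>.\<close>

definition cycle_graph :: "nat \<Rightarrow> (nat, nat) graph" where
  "cycle_graph n = \<lparr>verts = {..<n}, edges = {..<n}, ends = (\<lambda>i. {i, Suc i mod n})\<rparr>"

text \<open>
  The new vertex on the edge \<open>e\<close> is \<open>Inr e\<close>; the two halves of \<open>e\<close> correspond to the arcs
  \<open>(v, e)\<close>.  Subdividing the graph with two vertices and \<open>n\<close> parallel edges gives the simple
  graph \<open>K\<^sub>2\<^sub>,\<^sub>n\<close>, which is not the subdivision of a simple graph when \<open>n \<ge> 2\<close>.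
\<close>

definition subdivision :: "('v, 'e) graph \<Rightarrow> ('v + 'e, 'v \<times> 'e) graph" where
  "subdivision G =
     \<lparr>verts = verts G <+> edges G, edges = arcs G, ends = (\<lambda>(v, e). {Inl v, Inr e})\<rparr>"

lemma incident_edges_simple_bij:
  assumes "finite_graph G" "simple_graph G"
  shows "\<exists>t. bij_betw t {u. adjacent G v u} (incident_edges G v) \<and>
    (\<forall>u. adjacent G v u \<longrightarrow> ends G (t u) = {v, u} \<and> u \<noteq> v)"
proof -
  have ne: "u \<noteq> v" if "adjacent G v u" for u
    using that assms(1) by (auto simp: adjacent_def finite_graph_def)
  have "\<forall>u. \<exists>e. adjacent G v u \<longrightarrow> e \<in> edges G \<and> ends G e = {v, u}"
    by (auto simp: adjacent_def)
  then obtain t where t: "\<And>u. adjacent G v u \<Longrightarrow> t u \<in> edges G \<and> ends G (t u) = {v, u}"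
    by metis
  have "bij_betw t {u. adjacent G v u} (incident_edges G v)"
    unfolding bij_betw_def
  proof (intro conjI inj_onI equalityI subsetI)
    fix x y assume "x \<in> {u. adjacent G v u}" "y \<in> {u. adjacent G v u}" "t x = t y"
    then have "{v, x} = {v, y}" using t[of x] t[of y] by simp
    then show "x = y" by (auto simp: doubleton_eq_iff)
  next
    fix e assume "e \<in> t ` {u. adjacent G v u}"
    then show "e \<in> incident_edges G v" using t by (auto simp: incident_edges_def)
  next
    fix e assume "e \<in> incident_edges G v"
    then have e: "e \<in> edges G" "v \<in> ends G e" "card (ends G e) = 2"
      using assms(1) by (auto simp: incident_edges_def finite_graph_def)
    then obtain x y where "ends G e = {x, y}" by (auto simp: card_2_iff)
    then obtain u where u: "ends G e = {v, u}" using e(2) by (cases "v = x") (auto simp: insert_commute)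
    then have a: "adjacent G v u" using e by (auto simp: adjacent_def)
    then have "t u = e"
      using t[OF a] u e assms(2) by (auto simp: simple_graph_def dest: inj_onD)
    then show "e \<in> t ` {u. adjacent G v u}" using a by auto
  qed
  then show ?thesis using t ne by blast
qed

lemma locally_fully_symmetric_simple:
  assumes "finite_graph G" "simple_graph G"
  shows "locally_fully_symmetric G \<longleftrightarrow>
    (\<forall>v\<in>verts G. \<forall>p. p permutes {u. adjacent G v u} \<longrightarrow>
       (\<exists>f g. graph_aut G f g \<and> f v = v \<and> (\<forall>u. adjacent G v u \<longrightarrow> f u = p u)))"
    (is "_ \<longleftrightarrow> (\<forall>v\<in>_. ?N v)")
proof -
  have "(\<forall>p. p permutes incident_edges G v \<longrightarrow>
        (\<exists>f g. graph_aut G f g \<and> f v = v \<and> (\<forall>e\<in>incident_edges G v. g e = p e))) \<longleftrightarrow> ?N v"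
    (is "?E \<longleftrightarrow> _") if v: "v \<in> verts G" for v
  proof -
    let ?A = "{u. adjacent G v u}" and ?I = "incident_edges G v"
    obtain t where t: "bij_betw t ?A ?I"
      and te: "\<And>u. adjacent G v u \<Longrightarrow> ends G (t u) = {v, u} \<and> u \<noteq> v"
      using incident_edges_simple_bij[OF assms, of v] by metis
    have I: "e \<in> edges G" if "e \<in> ?I" for e using that by (auto simp: incident_edges_def)
    have key: "f u = w \<longleftrightarrow> g (t u) = t w"
      if "graph_aut G f g" "f v = v" "u \<in> ?A" "w \<in> ?A" for f g u w
    proof -
      have m: "t u \<in> edges G" "t w \<in> edges G"
        using t that I by (auto simp: bij_betw_def)
      then have "g (t u) \<in> edges G" "ends G (g (t u)) = {v, f u}"
        using that te[of u] by (auto simp: graph_iso_def bij_betw_def)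
      moreover have "ends G (t w) = {v, w}"
        using te[of w] that(4) by simp
      ultimately have "g (t u) = t w \<longleftrightarrow> {v, f u} = {v, w}"
        using inj_on_eq_iff[of "ends G" "edges G" "g (t u)" "t w"] m(2) assms(2)
        by (simp add: simple_graph_def)
      then show ?thesis by (auto simp: doubleton_eq_iff)
    qed
    show ?thesis
    proof (intro iffI allI impI)
      fix p assume E: ?E and p: "p permutes ?A"
      let ?s = "inv_into ?A t"
      define q where "q e = (if e \<in> ?I then t (p (?s e)) else e)" for e
      have "bij_betw (t \<circ> (p \<circ> ?s)) ?I ?I"
        by (intro bij_betw_trans[OF bij_betw_trans[OF bij_betw_inv_into[OF t]
              permutes_imp_bij[OF p]] t])
      then have "bij_betw q ?I ?I"
        by (rule bij_betw_cong[THEN iffD1, rotated]) (simp add: q_def)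
      then have "q permutes ?I" by (rule bij_imp_permutes) (simp add: q_def)
      then obtain f g where fg: "graph_aut G f g" "f v = v" "\<forall>e\<in>?I. g e = q e"
        using E by blast
      have "f u = p u" if "adjacent G v u" for u
      proof -
        have u: "u \<in> ?A" "p u \<in> ?A" "t u \<in> ?I" "?s (t u) = u"
          using that p t permutes_in_image[OF p, of u] by (auto simp: bij_betw_def)
        then show ?thesis using key[OF fg(1,2) u(1,2)] fg(3) by (simp add: q_def)
      qed
      then show "\<exists>f g. graph_aut G f g \<and> f v = v \<and> (\<forall>u. adjacent G v u \<longrightarrow> f u = p u)"
        using fg by blast
    next
      fix q assume N: "?N v" and q: "q permutes ?I"
      let ?s = "inv_into ?A t"
      define p where "p u = (if u \<in> ?A then ?s (q (t u)) else u)" for u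
      have "bij_betw (?s \<circ> (q \<circ> t)) ?A ?A"
        by (intro bij_betw_trans[OF bij_betw_trans[OF t permutes_imp_bij[OF q]]
              bij_betw_inv_into[OF t]])
      then have "bij_betw p ?A ?A"
        by (rule bij_betw_cong[THEN iffD1, rotated]) (simp add: p_def)
      then have p: "p permutes ?A" by (rule bij_imp_permutes) (simp add: p_def)
      then obtain f g where fg: "graph_aut G f g" "f v = v" "\<forall>u. adjacent G v u \<longrightarrow> f u = p u"
        using N by blast
      have "g e = q e" if "e \<in> ?I" for e
      proof -
        have "e \<in> t ` ?A" using that by (simp only: bij_betw_imp_surj_on[OF t])
        then obtain u where u: "u \<in> ?A" "e = t u" by (elim imageE)
        have pu: "p u \<in> ?A" using u(1) by (simp only: permutes_in_image[OF p])
        have "q e \<in> ?I" using that by (simp only: permutes_in_image[OF q])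
        then have "t (p u) = q e"
          unfolding p_def using u bij_betw_inv_into_right[OF t, of "q e"] by simp
        then show ?thesis using key[OF fg(1,2) u(1) pu] fg(3) u by (metis mem_Collect_eq)
      qed
      then show "\<exists>f g. graph_aut G f g \<and> f v = v \<and> (\<forall>e\<in>?I. g e = q e)"
        using fg by blast
    qed
  qed
  then show ?thesis by (simp add: locally_fully_symmetric_def)
qed

end

theory Submission
  imports Defs
begin

text \<open>
  Star-transitivity makes all vertices of the same valency equivalent, and all edges at a vertex.
  Hence the two ends of every edge of a connected star-transitive graph have the same valencies
  \<open>d \<le> k\<close> as those of one edge at a vertex of minimal valency \<open>d\<close>.  If \<open>d = 1\<close> the graph is
  \<open>K\<^sub>1\<^sub>,\<^sub>k\<close>; if \<open>d = k = 2\<close> iterating an automorphism that moves an arc one step forward traces out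
  a cycle; and if \<open>d = 2 < k\<close> every edge joins a vertex of valency two to one of valency \<open>k\<close>, so the
  graph is a subdivision, whose automorphisms descend because they preserve valencies.
  Whenever every edge has an end of valency at most two, st(edge)-transitivity is a consequence
  of star-transitivity, so it plays no role in the classification.
\<close>

subsection \<open>Graphs and isomorphisms\<close>

text \<open>Any bijection between the edges at two vertices of equal valency is a star isomorphism,
  and it may send a prescribed edge to a prescribed edge. So star-transitivity gives transitivity on
  the arcs leaving vertices of a given valency, and an automorphism takes the far end of an arc
  along: this is why one edge fixes the valencies across all edges. Conversely, a bijection between
  the two edges at one vertex of valency two and those at another is fixed by one value, so there
  transitivity on arcs already realises every star isomorphism. In the third case
  \<open>\<Sigma>\<close> may need parallel edges: in \<open>K_{2,k}\<close> with
  \<open>k \<ge> 3\<close> all vertices of valency two have the same neighbours. The edges of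
  \<open>\<Sigma>\<close> are therefore taken to be the vertices of valency two themselves, not
  pairs of vertices.\<close>

lemma finite_graph_ends:
  assumes "finite_graph G" "e \<in> edges G" "u \<in> ends G e"
  obtains w where "ends G e = {u, w}" "w \<noteq> u" "u \<in> verts G" "w \<in> verts G"
proof -
  have c: "card (ends G e) = 2" "ends G e \<subseteq> verts G"
    using assms by (auto simp: finite_graph_def)
  then obtain x y where "ends G e = {x, y}" "x \<noteq> y" by (auto simp: card_2_iff)
  then show ?thesis using that[of x] that[of y] assms(3) c(2) by (auto simp: insert_commute)
qed

lemma finite_graph_edge:
  assumes "finite_graph G" "e \<in> edges G"
  obtains x y where "ends G e = {x, y}" "x \<in> verts G" "y \<in> verts G"
proof -
  have "card (ends G e) = 2" "ends G e \<subseteq> verts G"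
    using assms by (auto simp: finite_graph_def)
  then show ?thesis using that by (auto simp: card_2_iff)
qed

lemma graph_iso_compose:
  assumes "graph_iso G H f g" "graph_iso H K f' g'"
  shows "graph_iso G K (f' \<circ> f) (g' \<circ> g)"
  unfolding graph_iso_def
proof (intro conjI ballI)
  show "bij_betw (f' \<circ> f) (verts G) (verts K)" "bij_betw (g' \<circ> g) (edges G) (edges K)"
    using assms by (auto simp: graph_iso_def intro: bij_betw_trans)
  fix e assume "e \<in> edges G"
  then show "ends K ((g' \<circ> g) e) = (f' \<circ> f) ` ends G e"
    using assms bij_betwE[of g "edges G" "edges H"] by (simp add: graph_iso_def image_comp)
qed

lemma graph_iso_inverse:
  assumes "finite_graph G" "graph_iso G H f g"
  shows "graph_iso H G (inv_into (verts G) f) (inv_into (edges G) g)"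
  unfolding graph_iso_def
proof (intro conjI ballI)
  have f: "bij_betw f (verts G) (verts H)" and g: "bij_betw g (edges G) (edges H)"
    using assms(2) by (auto simp: graph_iso_def)
  show "bij_betw (inv_into (verts G) f) (verts H) (verts G)"
    "bij_betw (inv_into (edges G) g) (edges H) (edges G)"
    using f g by (simp_all add: bij_betw_inv_into)
  fix e assume e: "e \<in> edges H"
  define e' where "e' = inv_into (edges G) g e"
  have e': "e' \<in> edges G" "g e' = e"
    using e g by (auto simp: e'_def bij_betw_def inv_into_into f_inv_into_f)
  then have "ends H e = f ` ends G e'" using assms(2) by (auto simp: graph_iso_def)
  moreover have "ends G e' \<subseteq> verts G" using assms(1) e' by (auto simp: finite_graph_def)
  ultimately show "ends G (inv_into (edges G) g e) = inv_into (verts G) f ` ends H e"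
    using f by (simp add: e'_def[symmetric] bij_betw_def inv_into_image_cancel)
qed

lemma isomorphic_sym:
  assumes "finite_graph G" "isomorphic G H"
  shows "isomorphic H G"
  using assms graph_iso_inverse by (fastforce simp: isomorphic_def)

text \<open>The ends of edges lie in \<open>verts G\<close>, where \<open>f\<close> is injective, so
  incidence is reflected as well as preserved.\<close>

lemma graph_iso_incident_edges:
  assumes "finite_graph G" "graph_iso G H f g" "v \<in> verts G"
  shows "bij_betw g (incident_edges G v) (incident_edges H (f v))"
proof -
  have f: "inj_on f (verts G)" and g: "inj_on g (edges G)" "g ` edges G = edges H"
    and en: "\<And>e. e \<in> edges G \<Longrightarrow> ends H (g e) = f ` ends G e"
    using assms(2) by (auto simp: graph_iso_def bij_betw_def)
  have sub: "\<And>e. e \<in> edges G \<Longrightarrow> ends G e \<subseteq> verts G"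
    using assms(1) by (auto simp: finite_graph_def)
  have "g ` incident_edges G v = incident_edges H (f v)"
  proof (intro equalityI subsetI)
    fix e' assume "e' \<in> incident_edges H (f v)"
    then have "e' \<in> g ` edges G" "f v \<in> ends H e'"
      using g(2) by (auto simp: incident_edges_def)
    then obtain e where e: "e \<in> edges G" "e' = g e" "f v \<in> f ` ends G e"
      using en by blast
    then have "v \<in> ends G e"
      using inj_on_image_mem_iff[OF f assms(3) sub] by blast
    then show "e' \<in> g ` incident_edges G v" using e by (auto simp: incident_edges_def)
  qed (use g en in \<open>auto simp: incident_edges_def\<close>)
  moreover have "inj_on g (incident_edges G v)"
    using g(1) by (auto simp: incident_edges_def inj_on_def)
  ultimately show ?thesis by (simp add: bij_betw_def)
qed

lemma graph_iso_valency:
  assumes "finite_graph G" "graph_iso G H f g" "v \<in> verts G"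
  shows "valency H (f v) = valency G v"
  using bij_betw_same_card[OF graph_iso_incident_edges[OF assms]] by (simp add: valency_def)

lemma finite_incident_edges: "finite_graph G \<Longrightarrow> finite (incident_edges G v)"
  by (auto simp: finite_graph_def incident_edges_def)

subsection \<open>Star-transitivity\<close>

text \<open>The centre is the only vertex in a star and its image is prescribed, so a star
  isomorphism amounts to a bijection of the incident edges. Later uses of star-transitivity go
  through this form, free of the sum type.\<close>

lemma star_transitive_iff:
  "star_transitive G \<longleftrightarrow>
     (\<forall>v1\<in>verts G. \<forall>v2\<in>verts G. \<forall>s. bij_betw s (incident_edges G v1) (incident_edges G v2) \<longrightarrow>
        (\<exists>f g. graph_aut G f g \<and> f v1 = v2 \<and> (\<forall>e\<in>incident_edges G v1. g e = s e)))"
  (is "_ \<longleftrightarrow> ?R")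
proof
  assume S: "star_transitive G"
  show ?R
  proof (intro ballI allI impI)
    fix v1 v2 s
    assume v: "v1 \<in> verts G" "v2 \<in> verts G"
      and s: "bij_betw s (incident_edges G v1) (incident_edges G v2)"
    define \<phi> where "\<phi> = map_sum (\<lambda>_ :: 'a. v2) s"
    have "star_iso G v1 v2 \<phi>"
      unfolding star_iso_def bij_betw_def
    proof (intro conjI)
      show "inj_on \<phi> (star G v1)"
        using s by (auto simp: star_def inj_on_def bij_betw_def \<phi>_def)
      show "\<phi> ` star G v1 = star G v2"
        by (simp add: star_def \<phi>_def image_image bij_betw_imp_surj_on[OF s, symmetric])
    qed (simp add: \<phi>_def)
    then obtain f g where "graph_aut G f g" "\<forall>x\<in>star G v1. map_sum f g x = \<phi> x"
      using S v unfolding star_transitive_def by blast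
    then show "\<exists>f g. graph_aut G f g \<and> f v1 = v2 \<and> (\<forall>e\<in>incident_edges G v1. g e = s e)"
      by (auto simp: star_def \<phi>_def)
  qed
next
  assume R: ?R
  show "star_transitive G"
    unfolding star_transitive_def
  proof (intro ballI allI impI)
    fix v1 v2 \<phi>
    assume v: "v1 \<in> verts G" "v2 \<in> verts G" and \<phi>: "star_iso G v1 v2 \<phi>"
    \<comment> \<open>\<open>projr\<close> is meaningful on the star: removing the two centres from
      the bijection leaves edges mapped to edges.\<close>
    define s where "s e = projr (\<phi> (Inr e))" for e
    have b: "bij_betw \<phi> (star G v1) (star G v2)" "\<phi> (Inl v1) = Inl v2"
      using \<phi> by (auto simp: star_iso_def)
    have "bij_betw \<phi> (star G v1 - {Inl v1}) (star G v2 - {Inl v2})"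
      using b by (intro bij_betw_DiffI) (auto simp: star_def)
    moreover have "star G v - {Inl v} = Inr ` incident_edges G v" for v
      by (auto simp: star_def)
    ultimately have b': "bij_betw \<phi> (Inr ` incident_edges G v1) (Inr ` incident_edges G v2)"
      by simp
    then have s: "\<phi> (Inr e) = Inr (s e)" if "e \<in> incident_edges G v1" for e
    proof -
      have "\<phi> (Inr e) \<in> Inr ` incident_edges G v2" using bij_betwE[OF b'] that by blast
      then show ?thesis by (auto simp: s_def)
    qed
    have "s ` incident_edges G v1 = incident_edges G v2"
      using arg_cong[OF bij_betw_imp_surj_on[OF b'], of "image projr"]
      by (simp add: image_image s_def)
    moreover have "inj_on s (incident_edges G v1)"
    proof (rule inj_onI)
      fix x y assume xy: "x \<in> incident_edges G v1" "y \<in> incident_edges G v1" "s x = s y"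
      then have "\<phi> (Inr x) = \<phi> (Inr y)" using s by simp
      then show "x = y" using inj_onD[OF bij_betw_imp_inj_on[OF b'], of "Inr x" "Inr y"] xy by simp
    qed
    ultimately have "bij_betw s (incident_edges G v1) (incident_edges G v2)"
      by (simp add: bij_betw_def)
    then obtain f g where "graph_aut G f g" "f v1 = v2" "\<forall>e\<in>incident_edges G v1. g e = s e"
      using R v by blast
    then show "\<exists>f g. graph_aut G f g \<and> (\<forall>x\<in>star G v1. map_sum f g x = \<phi> x)"
      using b(2) s by (auto simp: star_def)
  qed
qed

lemma star_transitiveD:
  assumes "star_transitive G" "v1 \<in> verts G" "v2 \<in> verts G"
    "bij_betw s (incident_edges G v1) (incident_edges G v2)"
  obtains f g where "graph_aut G f g" "f v1 = v2" "\<And>e. e \<in> incident_edges G v1 \<Longrightarrow> g e = s e"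
  using assms unfolding star_transitive_iff by metis

text \<open>Conjugation: the bijection \<open>s\<close> is carried along \<open>b\<close> to
  \<open>H\<close>, realised there by an automorphism, and that automorphism is carried
  back.\<close>

lemma star_transitive_iso:
  assumes G: "finite_graph G" and iso: "graph_iso G H a b" and H: "star_transitive H"
  shows "star_transitive G"
  unfolding star_transitive_iff
proof (intro ballI allI impI)
  fix v1 v2 s
  assume v: "v1 \<in> verts G" "v2 \<in> verts G"
    and s: "bij_betw s (incident_edges G v1) (incident_edges G v2)"
  let ?I = "incident_edges G" and ?a' = "inv_into (verts G) a" and ?b' = "inv_into (edges G) b"
  have a: "inj_on a (verts G)" and b: "inj_on b (edges G)" and av: "a v1 \<in> verts H" "a v2 \<in> verts H"
    using iso v by (auto simp: graph_iso_def bij_betw_def)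
  have sub: "?I v \<subseteq> edges G" for v by (auto simp: incident_edges_def)
  have bI: "bij_betw b (?I v) (incident_edges H (a v))" if "v \<in> verts G" for v
    using graph_iso_incident_edges[OF G iso that] .
  have "bij_betw (b \<circ> (s \<circ> inv_into (?I v1) b)) (incident_edges H (a v1)) (incident_edges H (a v2))"
    by (intro bij_betw_trans[OF bij_betw_trans[OF bij_betw_inv_into[OF bI] s] bI] v)
  then obtain f g where fg: "graph_aut H f g" "f (a v1) = a v2"
    and g': "\<And>e. e \<in> incident_edges H (a v1) \<Longrightarrow> g e = (b \<circ> (s \<circ> inv_into (?I v1) b)) e"
    using star_transitiveD[OF H av] by blast
  have g: "g e = b (s (inv_into (?I v1) b e))" if "e \<in> incident_edges H (a v1)" for e
    using g'[OF that] by simp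
  have "graph_aut G (?a' \<circ> (f \<circ> a)) (?b' \<circ> (g \<circ> b))"
    by (intro graph_iso_compose[OF graph_iso_compose[OF iso fg(1)]] graph_iso_inverse[OF G iso])
  moreover have "?a' (f (a v1)) = v2" using fg(2) a v by simp
  moreover have "?b' (g (b e)) = s e" if "e \<in> ?I v1" for e
  proof -
    have "b e \<in> incident_edges H (a v1)" "inv_into (?I v1) b (b e) = e"
      using bI[OF v(1)] that by (auto simp: bij_betw_def)
    moreover have "s e \<in> edges G" using s that sub by (auto simp: bij_betw_def)
    ultimately show ?thesis using g b by simp
  qed
  ultimately show "\<exists>f g. graph_aut G f g \<and> f v1 = v2 \<and> (\<forall>e\<in>?I v1. g e = s e)"
    by (intro exI[of _ "?a' \<circ> (f \<circ> a)"] exI[of _ "?b' \<circ> (g \<circ> b)"]) auto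
qed

text \<open>The complements of the two points have equal size and can be matched arbitrarily. For
  incident edges this yields star isomorphisms with one edge prescribed.\<close>

lemma bij_betw_extending_point:
  assumes "finite A" "finite B" "card A = card B" "a \<in> A" "b \<in> B"
  obtains s where "bij_betw s A B" "s a = b"
proof -
  have "card (A - {a}) = card (B - {b})" using assms by simp
  then obtain s where "bij_betw s (A - {a}) (B - {b})"
    using assms(1,2) by (metis finite_Diff finite_same_card_bij)
  then have "bij_betw (s(a := b)) (A - {a}) (B - {b})"
    by (rule bij_betw_cong[THEN iffD1, rotated]) simp
  then have "bij_betw (s(a := b)) A B"
    using notIn_Un_bij_betw3[of a "A - {a}" "s(a := b)" "B - {b}"] assms(4,5)
    by (simp add: insert_absorb)
  then show ?thesis using that[of "s(a := b)"] by simp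
qed

text \<open>With at most two possible values, one common value leaves no choice for the other. This
  turns control of one edge at a vertex of valency at most two into control of its whole
  star.\<close>

lemma bij_betw_eq_if_card_le_2:
  assumes "bij_betw g A B" "bij_betw s A B" "finite B" "card B \<le> 2" "a \<in> A" "g a = s a" "x \<in> A"
  shows "g x = s x"
proof (cases "x = a")
  case False
  have "s a \<in> B" using assms(2,5) by (rule bij_betwE[THEN bspec])
  then have "card (B - {s a}) \<le> Suc 0" using assms(3,4) by simp
  then have uniq: "\<forall>y\<in>B - {s a}. \<forall>z\<in>B - {s a}. y = z"
    using assms(3) by (simp only: card_le_Suc0_iff_eq[OF finite_Diff])
  have "g x \<in> B" "s x \<in> B" using assms(1,2,7) by (auto dest: bij_betwE)
  moreover have "g x \<noteq> s a"
    using inj_on_contraD[OF bij_betw_imp_inj_on[OF assms(1)] False assms(7,5)] assms(6) by simp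
  moreover have "s x \<noteq> s a"
    using inj_on_contraD[OF bij_betw_imp_inj_on[OF assms(2)] False assms(7,5)] .
  ultimately show ?thesis by (intro uniq[rule_format]) simp_all
qed (use assms(6) in simp)

text \<open>Equal valency is all that a bijection of incident edges requires, and one of its values
  is free to choose; so the arcs leaving vertices of one valency form a single orbit.\<close>

lemma star_transitive_arcs:
  assumes "finite_graph G" "star_transitive G" "u \<in> verts G" "u' \<in> verts G"
    "valency G u = valency G u'" "e \<in> incident_edges G u" "e' \<in> incident_edges G u'"
  obtains f g where "graph_aut G f g" "f u = u'" "g e = e'"
proof -
  obtain s where "bij_betw s (incident_edges G u) (incident_edges G u')" "s e = e'"
    using bij_betw_extending_point[of "incident_edges G u" "incident_edges G u'" e e'] assms
    by (auto simp: finite_incident_edges valency_def)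
  then show ?thesis using star_transitiveD[OF assms(2-4)] assms(6) that by metis
qed

text \<open>The two ends of \<open>e\<close> are distinct and \<open>f\<close> keeps them apart, so
  \<open>f w\<close> is the end of \<open>g e\<close> that differs from \<open>f u\<close>.\<close>

lemma graph_aut_other_end:
  assumes "finite_graph G" "graph_aut G f g" "e \<in> edges G" "ends G e = {u, w}"
    "ends G (g e) = {f u, y}"
  shows "f w = y"
proof -
  have "f ` {u, w} = {f u, y}" using assms by (auto simp: graph_iso_def)
  moreover have "u \<noteq> w" "u \<in> verts G" "w \<in> verts G"
    using finite_graph_ends[OF assms(1,3), of u] assms(4) by (auto simp: doubleton_eq_iff)
  moreover from this have "f u \<noteq> f w" using assms(2) by (auto simp: graph_iso_def bij_betw_def inj_on_def)
  ultimately show ?thesis by (auto simp: doubleton_eq_iff)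
qed

text \<open>
  An automorphism agreeing with \<open>\<phi>\<close> on the star of one end also agrees with it on the
  only further edge at an end of valency at most two.
\<close>

lemma st_edge_transitive_if_star_transitive:
  assumes G: "finite_graph G" "simple_graph G" and S: "star_transitive G"
    and val: "\<And>e. e \<in> edges G \<Longrightarrow> \<exists>v\<in>ends G e. valency G v \<le> 2"
  shows "st_edge_transitive G"
  unfolding st_edge_transitive_def
proof (intro ballI allI impI)
  fix e1 e2 \<phi>
  assume e: "e1 \<in> edges G" "e2 \<in> edges G" and \<phi>: "edge_star_iso G e1 e2 \<phi>"
  \<comment> \<open>The automorphism will come from the star of the other end \<open>u\<close>; at
    \<open>v\<close>, the end of small valency, the edge \<open>e1\<close> alone will control
    it.\<close>
  obtain v where v: "v \<in> ends G e1" "valency G v \<le> 2" using val[OF e(1)] by blast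
  obtain u where u: "ends G e1 = {v, u}" "u \<noteq> v" "v \<in> verts G" "u \<in> verts G"
    using finite_graph_ends[OF G(1) e(1) v(1)] by metis
  let ?I = "incident_edges G"
  \<comment> \<open>\<open>\<phi>\<close> splits into a map \<open>r\<close> on the two ends and a
    map \<open>s\<close> on edges: it sends ends to ends, hence the remaining elements of the edge
    star to edges.\<close>
  define s where "s e = projr (\<phi> (Inr e))" for e
  define r where "r x = projl (\<phi> (Inl x))" for x
  have bij: "bij_betw \<phi> (edge_star G e1) (edge_star G e2)"
    and im: "\<phi> ` Inl ` ends G e1 = Inl ` ends G e2"
    and inc: "\<And>f x. Inr f \<in> edge_star G e1 \<Longrightarrow> x \<in> ends G e1 \<Longrightarrow>
       incident G (Inr f) (Inl x) \<longleftrightarrow> incident G (\<phi> (Inr f)) (\<phi> (Inl x))"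
    using \<phi> by (auto simp: edge_star_iso_def)
  have r: "\<phi> (Inl x) = Inl (r x)" if "x \<in> ends G e1" for x
  proof -
    have "\<phi> (Inl x) \<in> \<phi> ` Inl ` ends G e1" using that by simp
    then show ?thesis unfolding im by (auto simp: r_def)
  qed
  have rim: "ends G e2 = r ` ends G e1"
    using arg_cong[OF im, of "image projl"] by (simp add: image_image r_def)
  have E: "edge_star G e = Inl ` ends G e \<union> Inr ` (\<Union>x\<in>ends G e. ?I x)" for e
    by (simp add: edge_star_def)
  have sub: "Inl ` ends G e \<subseteq> edge_star G e" for e
    by (simp add: E)
  have "bij_betw \<phi> (edge_star G e1 - Inl ` ends G e1) (edge_star G e2 - Inl ` ends G e2)"
    by (rule bij_betw_DiffI[OF bij bij_betw_subset[OF bij sub im] sub sub])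
  moreover have "edge_star G e - Inl ` ends G e = Inr ` (\<Union>x\<in>ends G e. ?I x)" for e
    by (auto simp: E)
  ultimately have bij': "bij_betw \<phi> (Inr ` (\<Union>x\<in>ends G e1. ?I x)) (Inr ` (\<Union>x\<in>ends G e2. ?I x))"
    by simp
  have s: "\<phi> (Inr f) = Inr (s f)" if "f \<in> ?I x" "x \<in> ends G e1" for f x
  proof -
    have "Inr f \<in> Inr ` (\<Union>x\<in>ends G e1. ?I x)" using that by auto
    then have "\<phi> (Inr f) \<in> Inr ` (\<Union>x\<in>ends G e2. ?I x)"
      using bij' by (metis bij_betwE)
    then show ?thesis by (auto simp: s_def)
  qed
  \<comment> \<open>Incidence preservation enters here: it makes \<open>s\<close> restrict to a
    bijection from the edges at each end to the edges at its image.\<close>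
  have sI: "bij_betw s (?I x) (?I (r x))" if x: "x \<in> ends G e1" for x
    unfolding bij_betw_def
  proof (intro conjI inj_onI equalityI subsetI)
    fix f f' assume f: "f \<in> ?I x" "f' \<in> ?I x" "s f = s f'"
    then have "\<phi> (Inr f) = \<phi> (Inr f')" using s[OF _ x] by simp
    moreover have "Inr f \<in> edge_star G e1" "Inr f' \<in> edge_star G e1" using f x by (auto simp: E)
    ultimately show "f = f'" using bij by (auto simp: bij_betw_def dest: inj_onD)
  next
    fix h assume "h \<in> s ` ?I x"
    then obtain f where f: "f \<in> ?I x" "h = s f" by blast
    have st: "Inr f \<in> edge_star G e1" using f x by (auto simp: E)
    then have "Inr h \<in> edge_star G e2" using bij s[OF f(1) x] f(2) by (metis bij_betwE)
    then have "h \<in> edges G" by (auto simp: E incident_edges_def)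
    moreover have "r x \<in> ends G h"
      using inc[OF st x] f s[OF f(1) x] r[OF x] by (auto simp: incident_edges_def)
    ultimately show "h \<in> ?I (r x)" by (simp add: incident_edges_def)
  next
    fix h assume h: "h \<in> ?I (r x)"
    then have "Inr h \<in> Inr ` (\<Union>x\<in>ends G e2. ?I x)" using x rim by auto
    then have "Inr h \<in> \<phi> ` Inr ` (\<Union>x\<in>ends G e1. ?I x)"
      by (simp only: bij_betw_imp_surj_on[OF bij'])
    then obtain f y where f: "f \<in> ?I y" "y \<in> ends G e1" "\<phi> (Inr f) = Inr h"
      by (elim imageE UN_E) simp
    then have "Inr f \<in> edge_star G e1" by (auto simp: E)
    \<comment> \<open>So far \<open>f\<close> is known only to lie at some end \<open>y\<close>; as
      incidence is also reflected, it lies at \<open>x\<close>.\<close>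
    from inc[OF this x] have "x \<in> ends G f" using f r[OF x] h by (auto simp: incident_edges_def)
    then have "f \<in> ?I x" using f by (auto simp: incident_edges_def)
    then show "h \<in> s ` ?I x" using f s[OF f(1,2)] by auto
  qed
  have ends2: "ends G e2 = {r v, r u}" using rim u by auto
  have rv: "r u \<in> verts G" "r v \<in> verts G"
    using ends2 G(1) e(2) by (auto simp: finite_graph_def)
  have mem: "v \<in> ends G e1" "u \<in> ends G e1" using u by auto
  have e1I: "e1 \<in> ?I u" "e1 \<in> ?I v" using e u by (auto simp: incident_edges_def)
  \<comment> \<open>\<open>e1\<close> belongs to the stars of both ends, so \<open>s e1\<close>
    joins \<open>r u\<close> to \<open>r v\<close>; simplicity then identifies it with
    \<open>e2\<close>.\<close>
  have se1I: "s e1 \<in> ?I (r u)" "s e1 \<in> ?I (r v)"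
    using sI mem e1I by (auto simp: bij_betw_def)
  then have se1: "s e1 \<in> edges G" "r u \<in> ends G (s e1)" "r v \<in> ends G (s e1)"
    by (auto simp: incident_edges_def)
  have "r u \<noteq> r v" using ends2 G(1) e(2) by (auto simp: finite_graph_def)
  moreover obtain w where "ends G (s e1) = {r u, w}"
    using finite_graph_ends[OF G(1) se1(1,2)] .
  ultimately have "ends G (s e1) = ends G e2" using se1(3) ends2 by auto
  then have se1: "s e1 = e2"
    using inj_onD[OF G(2)[unfolded simple_graph_def]] e(2) se1(1) by simp
  obtain f g where fg: "graph_aut G f g" "f u = r u" "\<And>e. e \<in> ?I u \<Longrightarrow> g e = s e"
    using star_transitiveD[OF S u(4) rv(1) sI[OF mem(2)]] by blast
  have fv: "f v = r v"
    by (rule graph_aut_other_end[OF G(1) fg(1) e(1), of u])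
      (use fg e1I se1 ends2 u in \<open>auto simp: insert_commute\<close>)
  have gI: "bij_betw g (?I v) (?I (r v))"
    using graph_iso_incident_edges[OF G(1) fg(1) u(3)] fv by simp
  have gv: "g h = s h" if h: "h \<in> ?I v" for h
  proof (rule bij_betw_eq_if_card_le_2[OF gI sI[OF mem(1)] _ _ e1I(2) _ h])
    show "finite (?I (r v))" using finite_incident_edges[OF G(1)] .
    show "card (?I (r v)) \<le> 2"
      using v(2) bij_betw_same_card[OF sI[OF mem(1)]] by (simp add: valency_def)
    show "g e1 = s e1" using fg(3) e1I(1) by simp
  qed
  have "\<forall>x\<in>edge_star G e1. map_sum f g x = \<phi> x"
    using fg fv gv r s u by (auto simp: E)
  then show "\<exists>f g. graph_aut G f g \<and> (\<forall>x\<in>edge_star G e1. map_sum f g x = \<phi> x)"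
    using fg(1) by blast
qed

text \<open>An arc whose start has the valency of one end of \<open>e\<close> is the image of the
  corresponding arc of \<open>e\<close>, so its far end has the valency of the other end. Along a
  path from \<open>v\<close> no third valency can appear.\<close>

lemma star_transitive_valencies:
  assumes G: "finite_graph G" "connected_graph G" and S: "star_transitive G"
    and e: "e \<in> edges G" "ends G e = {v, w}"
  shows "\<And>x. x \<in> verts G \<Longrightarrow> valency G x \<in> {valency G v, valency G w}"
    and "\<And>h. h \<in> edges G \<Longrightarrow>
      \<exists>x y. ends G h = {x, y} \<and> valency G x = valency G v \<and> valency G y = valency G w"
proof -
  have vw: "v \<in> verts G" "w \<in> verts G" "v \<noteq> w"
    using e G(1) by (auto simp: finite_graph_def)
  \<comment> \<open>Stated for either orientation \<open>(a, b)\<close> of \<open>e\<close>, since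
    \<open>x\<close> may have the valency of \<open>v\<close> or that of \<open>w\<close>.\<close>
  have other: "valency G y = valency G b"
    if "h \<in> edges G" "ends G h = {x, y}" "ends G e = {a, b}" "valency G x = valency G a" for h x y a b
  proof -
    have V: "x \<in> verts G" "a \<in> verts G" "b \<in> verts G"
      using that e G(1) by (auto simp: finite_graph_def)
    note val = that(4)[symmetric]
    have I: "e \<in> incident_edges G a" "h \<in> incident_edges G x"
      using that e(1) by (auto simp: incident_edges_def)
    obtain f g where fg: "graph_aut G f g" "f a = x" "g e = h"
      using star_transitive_arcs[OF G(1) S V(2,1) val I] .
    have "f b = y" using graph_aut_other_end[OF G(1) fg(1) e(1) that(3)] fg that(2) by simp
    then show ?thesis using graph_iso_valency[OF G(1) fg(1) V(3)] by simp
  qed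
  have e': "ends G e = {w, v}" using e by auto
  show V: "valency G x \<in> {valency G v, valency G w}" if "x \<in> verts G" for x
  proof -
    have "(adjacent G)\<^sup>*\<^sup>* v x" using G(2) vw that by (auto simp: connected_graph_def)
    then show ?thesis
    proof induction
      case (step x y)
      then show ?case using other[OF _ _ e(2)] other[OF _ _ e']
        by (auto simp: adjacent_def) 
    qed simp
  qed
  fix h assume h: "h \<in> edges G"
  then obtain x y where xy: "ends G h = {x, y}" "x \<in> verts G"
    using finite_graph_edge[OF G(1)] by metis
  show "\<exists>x y. ends G h = {x, y} \<and> valency G x = valency G v \<and> valency G y = valency G w"
    using V[OF xy(2)] other[OF h xy(1) e(2)] other[OF h xy(1) e'] xy(1) by (metis insert_commute insertE singletonD)
qed

subsection \<open>Stars\<close>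

lemma finite_graph_complete_bipartite: "finite_graph (complete_bipartite m n)"
  by (auto simp: finite_graph_def complete_bipartite_def)

lemma complete_bipartite_aut:
  assumes "bij_betw p {..<n} {..<n}"
  shows "graph_aut (complete_bipartite m n) (map_sum id p) (map_prod id p)"
proof -
  have "bij_betw (map_sum id p) ({..<m} <+> {..<n}) ({..<m} <+> {..<n})"
    unfolding bij_betw_def
  proof
    show "inj_on (map_sum id p) ({..<m} <+> {..<n})"
      using assms by (auto simp: bij_betw_def inj_on_def)
    have "map_sum id p ` ({..<m} <+> {..<n}) = {..<m} <+> p ` {..<n}"
      by (simp add: Plus_def image_Un image_image)
    then show "map_sum id p ` ({..<m} <+> {..<n}) = {..<m} <+> {..<n}"
      using assms by (simp add: bij_betw_def)
  qed
  moreover have "bij_betw (map_prod id p) ({..<m} \<times> {..<n}) ({..<m} \<times> {..<n})"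
    using assms by (auto simp: bij_betw_def map_prod_surj_on intro!: map_prod_inj_on)
  ultimately show ?thesis by (auto simp: graph_iso_def complete_bipartite_def)
qed

text \<open>The centre has valency \<open>n\<close> and a leaf valency one, so centre and leaf can
  correspond only when \<open>n = 1\<close>. A bijection at the centre is a permutation of the
  leaves; between two leaves a transposition suffices, each having a single edge.\<close>

lemma star_transitive_complete_bipartite_1: "star_transitive (complete_bipartite 1 n)"
  unfolding star_transitive_iff
proof (intro ballI allI impI)
  let ?K = "complete_bipartite 1 n"
  let ?I = "incident_edges ?K"
  fix v1 v2 s
  assume v: "v1 \<in> verts ?K" "v2 \<in> verts ?K" and s: "bij_betw s (?I v1) (?I v2)"
  let ?goal = "\<exists>f g. graph_aut ?K f g \<and> f v1 = v2 \<and> (\<forall>e\<in>?I v1. g e = s e)"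
  have centre: "?I (Inl 0) = Pair 0 ` {..<n}"
    by (auto simp: incident_edges_def complete_bipartite_def)
  have leaf: "?I (Inr j) = {(0, j)}" if "j < n" for j
    using that by (auto simp: incident_edges_def complete_bipartite_def)
  have cases: "v = Inl 0 \<or> (\<exists>j<n. v = Inr j)" if "v \<in> verts ?K" for v
    using that by (auto simp: complete_bipartite_def)
  have swap: ?goal if "n = 1" "v1 \<noteq> v2"
  proof -
    \<comment> \<open>The two vertices of a single edge are exchanged.
      \<open>case_sum Inr Inl\<close> does this because both carry the index 0.\<close>
    have "graph_aut ?K (case_sum Inr Inl) id"
      using that(1) by (auto simp: graph_iso_def complete_bipartite_def bij_betw_def inj_on_def lessThan_Suc
          image_iff Plus_def)
    moreover have "case_sum Inr Inl v1 = v2"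
      using cases[OF v(1)] cases[OF v(2)] that by auto
    moreover have "s e = e" if "e \<in> ?I v1" for e
    proof -
      have "\<And>v. v \<in> verts ?K \<Longrightarrow> ?I v = {(0, 0)}"
        using cases centre leaf \<open>n = 1\<close> by fastforce
      then show ?thesis using s v that by (simp add: bij_betw_def)
    qed
    ultimately show ?thesis by (intro exI[of _ "case_sum Inr Inl"] exI[of _ id]) auto
  qed
  have card: "card (?I v1) = card (?I v2)" using bij_betw_same_card[OF s] .
  have card_centre: "card (?I (Inl 0)) = n"
    unfolding centre by (simp add: card_image inj_on_def)
  consider "v1 = Inl 0" "v2 = Inl 0" | i j where "v1 = Inr i" "v2 = Inr j" "i < n" "j < n"
    | "n = 1" "v1 \<noteq> v2"
    using cases[OF v(1)] cases[OF v(2)] card card_centre leaf by fastforce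
  then show ?goal
  proof cases
    case 1
    define p where "p i = snd (s (0, i))" for i
    have sp: "s (0, i) = (0, p i)" if "i < n" for i
    proof -
      have "s (0, i) \<in> Pair 0 ` {..<n}"
        using s that 1 centre by (auto dest: bij_betwE)
      then show ?thesis by (auto simp: p_def)
    qed
    have "bij_betw (snd \<circ> (s \<circ> Pair 0)) {..<n} {..<n}"
      using s 1 centre
      by (intro bij_betw_trans[OF bij_betw_trans[of "Pair 0" _ "?I v1"]])
        (auto simp: bij_betw_def inj_on_def image_image)
    then have "bij_betw p {..<n} {..<n}" by (simp add: p_def[abs_def] comp_def)
    then have "graph_aut ?K (map_sum id p) (map_prod id p)" by (rule complete_bipartite_aut)
    then show ?thesis using 1 centre sp
      by (intro exI[of _ "map_sum id p"] exI[of _ "map_prod id p"]) auto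
  next
    case (2 i j)
    define p where "p = Transposition.transpose i j"
    have "p permutes {..<n}" using 2 by (auto simp: p_def intro: permutes_swap_id)
    then have "graph_aut ?K (map_sum id p) (map_prod id p)"
      by (intro complete_bipartite_aut permutes_imp_bij)
    moreover have "s (0, i) = (0, j)" using s 2 leaf by (simp add: bij_betw_def)
    ultimately show ?thesis using 2 leaf
      by (intro exI[of _ "map_sum id p"] exI[of _ "map_prod id p"]) (auto simp: p_def)
  qed (rule swap)
qed

text \<open>A path leaving \<open>w\<close> enters a leaf and can only return, so connectedness
  leaves nothing but \<open>w\<close> and its neighbours. The isomorphism is built from the model to
  \<open>L\<close>, out of an enumeration \<open>b\<close> of the edges at \<open>w\<close>.\<close>

lemma isomorphic_complete_bipartite_1:
  assumes L: "finite_graph L" "connected_graph L" and w: "w \<in> verts L"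
    and val: "\<And>e u. e \<in> edges L \<Longrightarrow> ends L e = {w, u} \<Longrightarrow> valency L u = 1"
  shows "isomorphic L (complete_bipartite 1 (valency L w))"
proof -
  let ?I = "incident_edges L" and ?n = "valency L w"
  obtain b where b: "bij_betw b {..<?n} (?I w)"
    using ex_bij_betw_nat_finite[OF finite_incident_edges[OF L(1), of w]]
    by (auto simp: valency_def lessThan_atLeast0)
  have bI: "b i \<in> edges L" "w \<in> ends L (b i)" if "i < ?n" for i
    using bij_betwE[OF b] that by (auto simp: incident_edges_def)
  have "\<exists>u. ends L (b i) = {w, u} \<and> u \<noteq> w \<and> u \<in> verts L" if "i < ?n" for i
    using finite_graph_ends[OF L(1) bI[OF that]] by metis
  then obtain t where t: "\<And>i. i < ?n \<Longrightarrow> ends L (b i) = {w, t i} \<and> t i \<noteq> w \<and> t i \<in> verts L"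
    by metis
  have leaf: "?I (t i) = {b i}" if "i < ?n" for i
  proof -
    have "card (?I (t i)) = 1" using val[OF bI(1)[OF that]] t[OF that] by (simp add: valency_def)
    moreover have "b i \<in> ?I (t i)" using bI[OF that] t[OF that] by (simp add: incident_edges_def)
    ultimately show ?thesis by (auto simp: card_1_singleton_iff)
  qed
  \<comment> \<open>A leaf has only one edge, so equal leaves come from equal edges; in particular
    no edges at \<open>w\<close> are parallel.\<close>
  have inj_t: "inj_on t {..<?n}"
  proof (rule inj_onI)
    fix i j assume ij: "i \<in> {..<?n}" "j \<in> {..<?n}" "t i = t j"
    then have "b i = b j" using leaf[of i] leaf[of j] by simp
    then show "i = j" using inj_onD[OF bij_betw_imp_inj_on[OF b]] ij by simp
  qed
  have reach: "x \<in> insert w (t ` {..<?n})" if "x \<in> verts L" for x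
  proof -
    have "(adjacent L)\<^sup>*\<^sup>* w x" using L(2) w that by (auto simp: connected_graph_def)
    then show ?thesis
    proof induction
      case (step x y)
      then obtain e where e: "e \<in> edges L" "ends L e = {x, y}" by (auto simp: adjacent_def)
      have "e \<in> b ` {..<?n}"
      proof (cases "x = w")
        case True
        then have "e \<in> ?I w" using e by (auto simp: incident_edges_def)
        then show ?thesis using b by (simp add: bij_betw_def)
      next
        case False
        then obtain i where "i < ?n" "x = t i" using step.IH by auto
        moreover have "e \<in> ?I x" using e by (auto simp: incident_edges_def)
        ultimately show ?thesis using leaf by auto
      qed
      then obtain i where "i < ?n" "e = b i" by auto
      then have "{x, y} = {w, t i}" using t e(2) by metis
      then have "y = w \<or> y = t i" by (auto simp: doubleton_eq_iff)
      then show ?case using \<open>i < ?n\<close> by auto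
    qed simp
  qed
  have edge: "e \<in> ?I w" if e: "e \<in> edges L" for e
  proof -
    obtain x y where xy: "ends L e = {x, y}" "x \<in> verts L"
      using finite_graph_edge[OF L(1) e] by metis
    have I: "e \<in> ?I x" using xy e by (auto simp: incident_edges_def)
    show ?thesis
    proof (cases "x = w")
      case False
      then obtain i where i: "i < ?n" "x = t i" using reach[OF xy(2)] by auto
      then have "e = b i" using I leaf by auto
      then show ?thesis using bij_betwE[OF b] i by auto
    qed (use I in simp)
  qed
  have "graph_iso (complete_bipartite 1 ?n) L (case_sum (\<lambda>_. w) t) (\<lambda>(i, j). b j)"
    unfolding graph_iso_def
  proof (intro conjI)
    show "bij_betw (case_sum (\<lambda>_. w) t) (verts (complete_bipartite 1 ?n)) (verts L)"
      unfolding bij_betw_def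
    proof
      show "inj_on (case_sum (\<lambda>_. w) t) (verts (complete_bipartite 1 ?n))"
      proof -
        have "inj_on (case_sum (\<lambda>_. w) t) ({..<1 :: nat} <+> {..<m})"
          if "inj_on t {..<m}" "w \<notin> t ` {..<m}" for m
          using that by (auto simp: inj_on_def)
        then show ?thesis using inj_t t by (force simp: complete_bipartite_def)
      qed
      have "case_sum (\<lambda>_. w) t ` verts (complete_bipartite 1 ?n) = insert w (t ` {..<?n})"
        by (auto simp: complete_bipartite_def Plus_def image_Un image_image)
      then show "case_sum (\<lambda>_. w) t ` verts (complete_bipartite 1 ?n) = verts L"
        using reach t w by auto
    qed
    show "bij_betw (\<lambda>(i, j). b j) (edges (complete_bipartite 1 ?n)) (edges L)"
      unfolding bij_betw_def
    proof
      show "inj_on (\<lambda>(i, j). b j) (edges (complete_bipartite 1 ?n))"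
        using bij_betw_imp_inj_on[OF b] by (auto simp: complete_bipartite_def inj_on_def)
      have "(\<lambda>(i, j). b j) ` edges (complete_bipartite 1 ?n) = b ` {..<?n}"
        by (force simp: complete_bipartite_def)
      then show "(\<lambda>(i, j). b j) ` edges (complete_bipartite 1 ?n) = edges L"
        using b edge by (auto simp: bij_betw_def incident_edges_def)
    qed
  qed (use t in \<open>auto simp: complete_bipartite_def\<close>)
  then show ?thesis
    using isomorphic_sym[OF finite_graph_complete_bipartite] unfolding isomorphic_def by blast
qed

subsection \<open>Cycles\<close>

text \<open>Mapping an arc fixes the images of a vertex and of one of its two edges; the second edge
  then has no choice.\<close>

lemma star_transitive_if_arc_transitive_2_regular:
  assumes G: "finite_graph G" "regular_graph 2 G" "arc_transitive G"
  shows "star_transitive G"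
  unfolding star_transitive_iff
proof (intro ballI allI impI)
  let ?I = "incident_edges G"
  fix v1 v2 s
  assume v: "v1 \<in> verts G" "v2 \<in> verts G" and s: "bij_betw s (?I v1) (?I v2)"
  have c: "card (?I v1) = 2" "card (?I v2) = 2" "finite (?I v2)"
    using G(2) v finite_incident_edges[OF G(1)] by (auto simp: regular_graph_def valency_def)
  then obtain e where e: "e \<in> ?I v1" by fastforce
  then have "s e \<in> ?I v2" using bij_betwE[OF s] by blast
  then have "(v1, e) \<in> arcs G" "(v2, s e) \<in> arcs G"
    using e by (auto simp: arcs_def incident_edges_def)
  then obtain f g where fg: "graph_aut G f g" "f v1 = v2" "g e = s e"
    using G(3) unfolding arc_transitive_def by fastforce
  have "g x = s x" if "x \<in> ?I v1" for x
    using graph_iso_incident_edges[OF G(1) fg(1) v(1)] fg(2) c(2)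
    by (intro bij_betw_eq_if_card_le_2[OF _ s c(3) _ e _ that]) (simp_all add: fg(3))
  then show "\<exists>f g. graph_aut G f g \<and> f v1 = v2 \<and> (\<forall>e\<in>?I v1. g e = s e)"
    using fg by blast
qed

section \<open>Dihedral symmetries of the standard cycle\<close>

lemma finite_graph_cycle_graph:
  assumes "n \<ge> 3"
  shows "finite_graph (cycle_graph n)"
proof -
  have "i \<noteq> Suc i mod n" if "i < n" for i
    using that assms by (cases "Suc i = n") auto
  then show ?thesis using assms by (auto simp: finite_graph_def cycle_graph_def card_insert_if)
qed

text \<open>Edge \<open>j\<close> runs from \<open>j\<close> to its successor, so the second edge at
  \<open>i\<close> is the cyclic predecessor of \<open>i\<close>, written additively to avoid
  truncated subtraction at 0.\<close>

lemma incident_edges_cycle_graph: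
  assumes "i < n"
  shows "incident_edges (cycle_graph n) i = {i, (i + (n - 1)) mod n}"
proof -
  have "i = Suc j mod n \<longleftrightarrow> j = (i + (n - 1)) mod n" if "j < n" for j
    using that assms by (cases "Suc j = n"; cases i) (auto simp: mod_if)
  then show ?thesis using assms by (auto simp: incident_edges_def cycle_graph_def)
qed

lemma regular_graph_cycle_graph:
  assumes "n \<ge> 3"
  shows "regular_graph 2 (cycle_graph n)"
proof -
  have "(i + (n - 1)) mod n \<noteq> i" if "i < n" for i
    using that assms by (cases i) (auto simp: mod_if)
  then show ?thesis
    using incident_edges_cycle_graph[of _ n]
    by (auto simp: regular_graph_def valency_def cycle_graph_def card_insert_if) metis
qed

lemma mod_add_right_cancel_nat:
  assumes "(a + c) mod n = (b + c) mod (n :: nat)"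
  shows "a mod n = b mod n"
proof (cases n)
  case (Suc m)
  \<comment> \<open>Subtraction of \<open>c\<close> is replaced by adding \<open>c * m\<close>,
    which completes \<open>c\<close> to \<open>c * n\<close>, a multiple of the modulus.\<close>
  have "(a + c + c * m) mod n = (b + c + c * m) mod n"
    using assms by (metis mod_add_left_eq)
  moreover have "x + c + c * m = x + c * n" for x by (simp add: Suc)
  ultimately show ?thesis by simp
qed (use assms in simp)

lemma cycle_graph_rotation:
  "graph_aut (cycle_graph n) (\<lambda>i. (i + c) mod n) (\<lambda>i. (i + c) mod n)"
proof -
  have "inj_on (\<lambda>i. (i + c) mod n) {..<n}"
  proof (rule inj_onI)
    fix i j assume ij: "i \<in> {..<n}" "j \<in> {..<n}" "(i + c) mod n = (j + c) mod n"
    have "i mod n = j mod n" using ij(3) by (rule mod_add_right_cancel_nat)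
    then show "i = j" using ij by simp
  qed
  moreover have "(\<lambda>i. (i + c) mod n) ` {..<n} \<subseteq> {..<n}" by auto
  ultimately have "bij_betw (\<lambda>i. (i + c) mod n) {..<n} {..<n}"
    by (simp add: bij_betw_def endo_inj_surj)
  then show ?thesis by (simp add: graph_iso_def cycle_graph_def mod_simps)
qed

text \<open>This is the reflection sending \<open>i\<close> to \<open>c - i\<close> modulo
  \<open>n\<close>. The edge from \<open>i\<close> to \<open>i + 1\<close> lands on the edge from
  \<open>c - i - 1\<close> to \<open>c - i\<close>, which is named by its first end; hence
  \<open>Suc i\<close> in the edge map.\<close>

lemma cycle_graph_reflection:
  "graph_aut (cycle_graph n) (\<lambda>i. (c + (n - i)) mod n) (\<lambda>i. (c + (n - Suc i)) mod n)"
proof -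
  have inj: "inj_on (\<lambda>i. (c + (n - i)) mod n) {..<n}"
    "inj_on (\<lambda>i. (c + (n - Suc i)) mod n) {..<n}"
  proof -
    have cancel: "a mod n = b mod n" if "(c + a) mod n = (c + b) mod n" for a b
      using that mod_add_right_cancel_nat[of a c n b] by (simp add: add.commute)
    show "inj_on (\<lambda>i. (c + (n - i)) mod n) {..<n}"
    proof (rule inj_onI)
      fix i j assume ij: "i \<in> {..<n}" "j \<in> {..<n}" "(c + (n - i)) mod n = (c + (n - j)) mod n"
      have "(n - i) mod n = (n - j) mod n" using ij(3) by (rule cancel)
      then show "i = j" using ij by (cases i; cases j) auto
    qed
    show "inj_on (\<lambda>i. (c + (n - Suc i)) mod n) {..<n}"
    proof (rule inj_onI)
      fix i j
      assume ij: "i \<in> {..<n}" "j \<in> {..<n}" "(c + (n - Suc i)) mod n = (c + (n - Suc j)) mod n"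
      have "(n - Suc i) mod n = (n - Suc j) mod n" using ij(3) by (rule cancel)
      then show "i = j" using ij by auto
    qed
  qed
  have bij: "bij_betw h {..<n} {..<n}" if "inj_on h {..<n}" "h ` {..<n} \<subseteq> {..<n}" for h
    using that by (simp add: bij_betw_def endo_inj_surj)
  have "bij_betw (\<lambda>i. (c + (n - i)) mod n) {..<n} {..<n}"
    "bij_betw (\<lambda>i. (c + (n - Suc i)) mod n) {..<n} {..<n}"
    by (rule bij[OF inj(1)], auto, rule bij[OF inj(2)], auto)
  moreover have "{(c + (n - Suc i)) mod n, Suc ((c + (n - Suc i)) mod n) mod n} =
      {(c + (n - i)) mod n, (c + (n - Suc i mod n)) mod n}" if "i < n" for i
  proof -
    have "Suc ((c + (n - Suc i)) mod n) mod n = (c + (n - i)) mod n"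
      using that by (simp add: mod_simps Suc_diff_Suc)
    moreover have "(c + (n - Suc i mod n)) mod n = (c + (n - Suc i)) mod n"
      using that by (cases "Suc i = n") auto
    ultimately show ?thesis by (simp add: insert_commute)
  qed
  ultimately show ?thesis by (simp add: graph_iso_def cycle_graph_def)
qed

lemma arc_transitive_cycle_graph: "arc_transitive (cycle_graph n)"
  unfolding arc_transitive_def
proof (intro ballI)
  fix a b assume ab: "a \<in> arcs (cycle_graph n)" "b \<in> arcs (cycle_graph n)"
  then obtain i j where ij: "i < n" "a = (i, i) \<or> a = (Suc i mod n, i)"
    "j < n" "b = (j, j) \<or> b = (Suc j mod n, j)"
    by (auto simp: arcs_def cycle_graph_def)
  \<comment> \<open>\<open>(i, i)\<close> runs forward along the edge \<open>i\<close>, the other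
    arc backward. Arcs of the same direction are matched by a rotation, arcs of opposite direction
    by a reflection.\<close>
  show "\<exists>f g. graph_aut (cycle_graph n) f g \<and> map_prod f g a = b"
  proof (cases "(a = (i, i)) = (b = (j, j))")
    case True
    \<comment> \<open>The shift \<open>j + (n - i)\<close> is \<open>j - i\<close> modulo
      \<open>n\<close>.\<close>
    have "(Suc i mod n + (j + (n - i))) mod n = (Suc i + (j + (n - i))) mod n"
      by (simp only: mod_simps)
    also have "Suc i + (j + (n - i)) = Suc j + n" using ij(1) by simp
    also have "(Suc j + n) mod n = Suc j mod n" by (rule mod_add_self2)
    finally have "(Suc i mod n + (j + (n - i))) mod n = Suc j mod n" .
    then have "map_prod (\<lambda>x. (x + (j + (n - i))) mod n) (\<lambda>x. (x + (j + (n - i))) mod n) a = b"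
      using True ij by auto
    then show ?thesis using cycle_graph_rotation by blast
  next
    case False
    \<comment> \<open>The constant \<open>i + j + 1\<close> is the one for which the reflection
      exchanges the roles of the ends: \<open>i\<close> goes to \<open>j + 1\<close> and
      \<open>i + 1\<close> to \<open>j\<close>.\<close>
    have "map_prod (\<lambda>x. (Suc (i + j) + (n - x)) mod n) (\<lambda>x. (Suc (i + j) + (n - Suc x)) mod n) a = b"
    proof -
      have "(Suc (i + j) + (n - Suc i mod n)) mod n = j"
      proof (cases "Suc i = n")
        case True
        then have "Suc (i + j) + (n - Suc i mod n) = j + n * 2" by auto
        then show ?thesis using ij(3) by (simp only: mod_mult_self2 mod_less)
      next
        case False
        then have "Suc (i + j) + (n - Suc i mod n) = j + n" using ij(1) by auto
        then show ?thesis using ij(3) by (simp only: mod_add_self2 mod_less)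
      qed
      moreover have "Suc (j + n) mod n = Suc j mod n" using mod_add_self2[of "Suc j" n] by simp
      ultimately show ?thesis using False ij by auto
    qed
    then show ?thesis using cycle_graph_reflection by blast
  qed
qed

lemma star_transitive_cycle_graph: "n \<ge> 3 \<Longrightarrow> star_transitive (cycle_graph n)"
  by (intro star_transitive_if_arc_transitive_2_regular finite_graph_cycle_graph
      regular_graph_cycle_graph arc_transitive_cycle_graph)

text \<open>The orbit of \<open>v\<close> is a walk that never turns back. Its first return closes a
  cycle containing every edge at each of its vertices, so connectedness makes it all of
  \<open>L\<close>.\<close>

lemma isomorphic_cycle_graph:
  assumes L: "finite_graph L" "simple_graph L" "connected_graph L" "star_transitive L"
    "regular_graph 2 L"
  shows "\<exists>n\<ge>3. isomorphic L (cycle_graph n)"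
proof -
  let ?I = "incident_edges L"
  have c2: "card (?I v) = 2" if "v \<in> verts L" for v
    using L(5) that by (simp add: regular_graph_def valency_def)
  obtain v where v: "v \<in> verts L" using L(3) by (auto simp: connected_graph_def)
  then obtain e where e: "e \<in> ?I v" using c2 by fastforce
  then have e': "e \<in> edges L" "v \<in> ends L e" by (auto simp: incident_edges_def)
  obtain w where w: "ends L e = {v, w}" "w \<in> verts L"
    using finite_graph_ends[OF L(1) e'] by metis
  have ew: "e \<in> ?I w" using e' w by (simp add: incident_edges_def)
  \<comment> \<open>Sending \<open>e\<close> to the second edge \<open>d\<close> at \<open>w\<close>
    is what makes the automorphism step forward instead of reversing \<open>e\<close>.\<close>
  then have "\<exists>d\<in>?I w. d \<noteq> e"
    using c2[OF w(2)] by (metis card_2_iff insertI1 insertI2 singletonI)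
  then obtain d where d: "d \<in> ?I w" "d \<noteq> e" by blast
  have "valency L v = valency L w" using c2 v w by (simp add: valency_def)
  from star_transitive_arcs[OF L(1,4) v w(2) this e d(1)]
  obtain f g where fg: "graph_aut L f g" "f v = w" "g e = d" .
  have f: "inj_on f (verts L)" "\<And>x. x \<in> verts L \<Longrightarrow> f x \<in> verts L"
    and g: "inj_on g (edges L)" "\<And>x. x \<in> edges L \<Longrightarrow> g x \<in> edges L"
    and fg_ends: "\<And>x. x \<in> edges L \<Longrightarrow> ends L (g x) = f ` ends L x"
    using fg(1) by (auto simp: graph_iso_def bij_betw_def)
  define x where "x i = (f ^^ i) v" for i
  define h where "h i = (g ^^ i) e" for i
  have x0: "x 0 = v" "x (Suc i) = f (x i)" for i by (simp_all add: x_def)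
  have h0: "h 0 = e" "h (Suc i) = g (h i)" for i by (simp_all add: h_def)
  have xv: "x i \<in> verts L" for i by (induction i) (simp_all add: x0 v f)
  have he: "h i \<in> edges L" for i by (induction i) (simp_all add: h0 e' g)
  have hx: "ends L (h i) = {x i, x (Suc i)}" for i
    by (induction i) (simp_all add: h0 x0 w fg fg_ends he)
  have hne: "h (Suc i) \<noteq> h i" for i
  proof (induction i)
    case (Suc i)
    then show ?case using inj_onD[OF g(1)] he by (metis h0(2))
  qed (simp add: h0 fg d)
  have x_ne: "x (Suc i) \<noteq> x i" for i
    using L(1) he[of i] hx[of i] by (force simp: finite_graph_def)
  \<comment> \<open>Turning back would give two consecutive edges the same ends, against
    simplicity.\<close>
  have x_ne2: "x (Suc (Suc i)) \<noteq> x i" for i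
  proof
    assume "x (Suc (Suc i)) = x i"
    then have "ends L (h (Suc i)) = ends L (h i)" by (simp add: hx insert_commute)
    then show False using inj_onD[OF L(2)[unfolded simple_graph_def]] he hne by blast
  qed
  have Ix: "?I (x (Suc i)) = {h i, h (Suc i)}" for i
  proof (rule card_seteq[symmetric])
    show "finite (?I (x (Suc i)))" by (rule finite_incident_edges[OF L(1)])
    show "{h i, h (Suc i)} \<subseteq> ?I (x (Suc i))"
      using he hx by (auto simp: incident_edges_def)
    show "card (?I (x (Suc i))) \<le> card {h i, h (Suc i)}"
      using c2[OF xv, of "Suc i"] hne[of i] by (simp add: card_insert_if)
  qed
  \<comment> \<open>Injectivity of \<open>f\<close> pulls any repetition back to time 0, so the
    first vertex to be repeated is the start.\<close>
  have x_cancel: "x k = x 0" if "x (i + k) = x i" for i k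
    using that
  proof (induction i)
    case (Suc i)
    then have "x (i + k) = x i" using inj_onD[OF f(1)] xv by (metis add_Suc x0(2))
    then show ?case by (rule Suc.IH)
  qed simp
  have h_cancel: "h k = h 0" if "h (i + k) = h i" for i k
    using that
  proof (induction i)
    case (Suc i)
    then have "h (i + k) = h i" using inj_onD[OF g(1)] he by (metis add_Suc h0(2))
    then show ?case by (rule Suc.IH)
  qed simp
  have ex: "\<exists>n. n > 0 \<and> x n = x 0"
  proof -
    have "finite (range x)"
      using L(1) xv by (auto simp: finite_graph_def intro: finite_subset)
    then have "\<not> inj x" using finite_imageD by blast
    then obtain i j where "i < j" "x i = x j"
      by (metis injI linorder_neqE_nat)
    then have "x (i + (j - i)) = x i" by simp
    then show ?thesis using x_cancel \<open>i < j\<close> zero_less_diff by blast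
  qed
  define n where "n = (LEAST n. n > 0 \<and> x n = x 0)"
  have n: "n > 0" "x n = x 0" using LeastI_ex[OF ex] by (simp_all add: n_def)
  have minimal: "x k \<noteq> x 0" if "0 < k" "k < n" for k
    using not_less_Least[of k "\<lambda>n. n > 0 \<and> x n = x 0"] that by (simp add: n_def)
  have n3: "n \<ge> 3"
  proof -
    have "n \<noteq> 1" "n \<noteq> 2" using n x_ne[of 0] x_ne2[of 0] by (auto simp: numeral_2_eq_2)
    then show ?thesis using n(1) by linarith
  qed
  have inj_x: "inj_on x {..<n}"
  proof (rule linorder_inj_onI)
    fix i j assume "i < j" "i \<in> {..<n}" "j \<in> {..<n}"
    then show "x i \<noteq> x j" using x_cancel[of i "j - i"] minimal[of "j - i"] by auto
  qed auto
  \<comment> \<open>If \<open>h i = h j\<close>, the edge \<open>h (j - i)\<close> has the ends of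
    \<open>h 0\<close>. Equal order contradicts minimality of \<open>n\<close>; reversed order
    forces \<open>j - i = 1\<close> and \<open>x 2 = x 0\<close>, a turn back.\<close>
  have inj_h: "inj_on h {..<n}"
  proof (rule linorder_inj_onI)
    fix i j assume ij: "i < j" "i \<in> {..<n}" "j \<in> {..<n}"
    show "h i \<noteq> h j"
    proof
      assume "h i = h j"
      then have "h (j - i) = h 0" using h_cancel[of i "j - i"] ij by simp
      then have "{x (j - i), x (Suc (j - i))} = {x 0, x 1}" using hx by (metis One_nat_def)
      then have "x (j - i) = x 1 \<and> x (Suc (j - i)) = x 0"
        using minimal[of "j - i"] ij by (auto simp: doubleton_eq_iff)
      moreover from this have "j - i = 1"
        using inj_onD[OF inj_x, of "j - i" 1] ij n3 by simp
      ultimately show False using x_ne2[of 0] by simp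
    qed
  qed auto
  \<comment> \<open>A priori only the vertices return at time \<open>n\<close>. The vertex
    \<open>x n = x 0\<close> has just the edges \<open>h (n - 1)\<close> and \<open>h n\<close>, and
    \<open>h 0\<close> is not the former.\<close>
  have hn: "h n = h 0"
  proof -
    obtain m where m: "n = Suc m" using n(1) by (cases n) auto
    have "h 0 \<in> ?I (x (Suc m))" using he hx n m by (simp add: incident_edges_def)
    then have "h 0 = h m \<or> h 0 = h n" unfolding Ix using m by simp
    moreover have "h 0 \<noteq> h m" using inj_onD[OF inj_h, of 0 m] m n3 by auto
    ultimately show ?thesis by simp
  qed
  have Ih: "?I (x i) \<subseteq> h ` {..<n}" if "i < n" for i
  proof (cases i)
    case 0
    obtain m where m: "n = Suc m" using n(1) by (cases n) auto
    then have "?I (x 0) = {h m, h 0}" using Ix[of m] n hn by simp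
    then show ?thesis using 0 m by auto
  next
    case (Suc j)
    then show ?thesis using Ix[of j] that by auto
  qed
  have x_mod: "x (Suc i mod n) = x (Suc i)" if "i < n" for i
    using that n by (cases "Suc i = n") auto
  have reach: "y \<in> x ` {..<n}" if "y \<in> verts L" for y
  proof -
    have "(adjacent L)\<^sup>*\<^sup>* v y" using L(3) v that by (auto simp: connected_graph_def)
    then show ?thesis
    proof induction
      case base
      then show ?case using n(1) x0(1) by (metis imageI lessThan_iff)
    next
      case (step y z)
      then obtain k where k: "k \<in> edges L" "ends L k = {y, z}" by (auto simp: adjacent_def)
      obtain i where "i < n" "y = x i" using step.IH by auto
      moreover have "k \<in> ?I y" using k by (simp add: incident_edges_def)
      ultimately obtain j where j: "j < n" "k = h j" using Ih[of i] by auto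
      then have "z \<in> {x j, x (Suc j)}" using hx[of j] k(2) by auto
      then have "z = x j \<or> z = x (Suc j mod n)" using x_mod[OF j(1)] by auto
      moreover have "Suc j mod n < n" using n(1) by simp
      ultimately show ?case using j(1) by blast
    qed
  qed
  have edge: "k \<in> h ` {..<n}" if k: "k \<in> edges L" for k
  proof -
    obtain y z where y: "ends L k = {y, z}" "y \<in> verts L"
      using finite_graph_edge[OF L(1) k] by metis
    then obtain i where "i < n" "y = x i" using reach by auto
    moreover have "k \<in> ?I y" using k y by (simp add: incident_edges_def)
    ultimately show ?thesis using Ih by blast
  qed
  have "graph_iso (cycle_graph n) L x h"
    using inj_x inj_h xv he reach edge hx x_mod
    by (auto simp: graph_iso_def cycle_graph_def bij_betw_def)
  then show ?thesis
    using n3 isomorphic_sym[OF finite_graph_cycle_graph] unfolding isomorphic_def by blast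
qed

subsection \<open>Subdivisions\<close>

lemma finite_graph_subdivision:
  assumes "finite_graph G"
  shows "finite_graph (subdivision G)"
proof -
  have "arcs G \<subseteq> verts G \<times> edges G"
    using assms by (auto simp: arcs_def finite_graph_def)
  moreover have "finite (verts G)" "finite (edges G)"
    using assms by (auto simp: finite_graph_def)
  ultimately show ?thesis
    by (auto simp: finite_graph_def subdivision_def intro: finite_subset)
qed

lemma incident_edges_subdivision:
  "incident_edges (subdivision G) (Inl v) = Pair v ` incident_edges G v"
  "e \<in> edges G \<Longrightarrow> incident_edges (subdivision G) (Inr e) = (\<lambda>v. (v, e)) ` ends G e"
  by (auto simp: incident_edges_def subdivision_def arcs_def)

lemma valency_subdivision:
  "valency (subdivision G) (Inl v) = valency G v"
  "finite_graph G \<Longrightarrow> e \<in> edges G \<Longrightarrow> valency (subdivision G) (Inr e) = 2"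
proof -
  show "valency (subdivision G) (Inl v) = valency G v"
    by (simp add: valency_def incident_edges_subdivision card_image inj_on_def)
  assume "finite_graph G" "e \<in> edges G"
  then show "valency (subdivision G) (Inr e) = 2"
    by (simp add: valency_def incident_edges_subdivision card_image inj_on_def finite_graph_def)
qed

lemma subdivision_aut:
  assumes G: "finite_graph G" and fg: "graph_aut G f g"
  shows "graph_aut (subdivision G) (map_sum f g) (map_prod f g)"
proof -
  have f: "inj_on f (verts G)" "f ` verts G = verts G"
    and g: "inj_on g (edges G)" "g ` edges G = edges G"
    and en: "\<And>e. e \<in> edges G \<Longrightarrow> ends G (g e) = f ` ends G e"
    using fg by (auto simp: graph_iso_def bij_betw_def)
  have "bij_betw (map_sum f g) (verts G <+> edges G) (verts G <+> edges G)"
    unfolding bij_betw_def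
  proof
    show "inj_on (map_sum f g) (verts G <+> edges G)"
      by (rule inj_onI) (auto dest: inj_onD[OF f(1)] inj_onD[OF g(1)])
    have "map_sum f g ` (verts G <+> edges G) = f ` verts G <+> g ` edges G"
      by (simp add: Plus_def image_Un image_image)
    then show "map_sum f g ` (verts G <+> edges G) = verts G <+> edges G"
      using f g by simp
  qed
  moreover have "bij_betw (map_prod f g) (arcs G) (arcs G)"
    unfolding bij_betw_def
  proof
    have "arcs G \<subseteq> verts G \<times> edges G"
      using G by (auto simp: arcs_def finite_graph_def)
    then show "inj_on (map_prod f g) (arcs G)"
      using map_prod_inj_on[OF f(1) g(1)] inj_on_subset by blast
    show "map_prod f g ` arcs G = arcs G"
    proof (intro equalityI subsetI)
      fix a assume "a \<in> map_prod f g ` arcs G"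
      then show "a \<in> arcs G" using g en by (auto simp: arcs_def)
    next
      fix a assume "a \<in> arcs G"
      then obtain v e where a: "a = (v, e)" "e \<in> edges G" "v \<in> ends G e"
        by (auto simp: arcs_def)
      then obtain e' where e': "e' \<in> edges G" "e = g e'" using g(2) by auto
      then obtain v' where "v' \<in> ends G e'" "v = f v'" using en a by auto
      then show "a \<in> map_prod f g ` arcs G"
        using a e' by (intro image_eqI[of _ _ "(v', e')"]) (auto simp: arcs_def)
    qed
  qed
  ultimately show ?thesis by (auto simp: graph_iso_def subdivision_def arcs_def)
qed

text \<open>The bound on valencies separates old vertices from new ones. In a subdivided cycle, a
  rotation by one step would exchange the two kinds and could not descend.\<close>

lemma subdivision_aut_descends:
  assumes G: "finite_graph G" and FH: "graph_aut (subdivision G) F H"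
    and val: "\<And>v. v \<in> verts G \<Longrightarrow> valency G v \<noteq> 2"
  obtains f g where "graph_aut G f g" "\<And>v. v \<in> verts G \<Longrightarrow> F (Inl v) = Inl (f v)"
    "\<And>e. e \<in> edges G \<Longrightarrow> F (Inr e) = Inr (g e)"
    "\<And>v e. (v, e) \<in> arcs G \<Longrightarrow> H (v, e) = (f v, g e)"
proof -
  let ?S = "subdivision G"
  define f where "f v = projl (F (Inl v))" for v
  define g where "g e = projr (F (Inr e))" for e
  have vS: "verts ?S = verts G <+> edges G" and eS: "edges ?S = arcs G"
    and enS: "\<And>v e. ends ?S (v, e) = {Inl v, Inr e}"
    by (auto simp: subdivision_def)
  have F: "inj_on F (verts ?S)" "\<And>x. x \<in> verts ?S \<Longrightarrow> F x \<in> verts ?S"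
    using FH by (auto simp: graph_iso_def bij_betw_def)
  have valF: "valency ?S (F x) = valency ?S x" if "x \<in> verts ?S" for x
    using graph_iso_valency[OF finite_graph_subdivision[OF G] FH that] .
  have Fv: "F (Inl v) = Inl (f v)" "f v \<in> verts G" if v: "v \<in> verts G" for v
  proof -
    have m: "Inl v \<in> verts ?S" using v by (auto simp: vS)
    have "F (Inl v) \<noteq> Inr e" if "e \<in> edges G" for e
      using valF[OF m] val[OF v] valency_subdivision(2)[OF G that]
      by (auto simp: valency_subdivision(1))
    then show "F (Inl v) = Inl (f v)" "f v \<in> verts G"
      using F(2)[OF m] unfolding vS by (auto simp: f_def)
  qed
  have Fe: "F (Inr e) = Inr (g e)" "g e \<in> edges G" if e: "e \<in> edges G" for e
  proof -
    have m: "Inr e \<in> verts ?S" using e by (auto simp: vS)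
    have "F (Inr e) \<noteq> Inl v" if "v \<in> verts G" for v
      using valF[OF m] val[OF that] valency_subdivision(2)[OF G e]
      by (auto simp: valency_subdivision(1))
    then show "F (Inr e) = Inr (g e)" "g e \<in> edges G"
      using F(2)[OF m] unfolding vS by (auto simp: g_def)
  qed
  have inj: "inj_on f (verts G)" "inj_on g (edges G)"
  proof -
    show "inj_on f (verts G)"
    proof (rule inj_onI)
      fix x y assume xy: "x \<in> verts G" "y \<in> verts G" "f x = f y"
      then have "F (Inl x) = F (Inl y)" by (simp add: Fv(1))
      from inj_onD[OF F(1) this] show "x = y" using xy by (auto simp: vS)
    qed
    show "inj_on g (edges G)"
    proof (rule inj_onI)
      fix x y assume xy: "x \<in> edges G" "y \<in> edges G" "g x = g y"
      then have "F (Inr x) = F (Inr y)" by (simp add: Fe(1))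
      from inj_onD[OF F(1) this] show "x = y" using xy by (auto simp: vS)
    qed
  qed
  \<comment> \<open>Even if \<open>G\<close> has parallel edges, a half edge is determined by its
    two ends, since one of them is the new vertex of \<open>e\<close>. So \<open>F\<close>
    determines \<open>H\<close>.\<close>
  have H: "H (v, e) = (f v, g e)" if a: "(v, e) \<in> arcs G" for v e
  proof -
    have ve: "v \<in> verts G" "e \<in> edges G" using a G by (auto simp: arcs_def finite_graph_def)
    obtain v' e' where H: "H (v, e) = (v', e')" by (cases "H (v, e)")
    have "ends ?S (H (v, e)) = F ` ends ?S (v, e)"
      using FH a unfolding graph_iso_def eS by blast
    then have "{Inl v', Inr e'} = {Inl (f v), Inr (g e)}"
      by (simp only: H enS Fv(1)[OF ve(1)] Fe(1)[OF ve(2)] image_insert image_empty)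
    then show ?thesis using H by (auto simp: doubleton_eq_iff)
  qed
  \<comment> \<open>Both sides have two elements, so one inclusion suffices; it is incidence of the
    image half edges.\<close>
  have "ends G (g e) = f ` ends G e" if e: "e \<in> edges G" for e
  proof (rule card_seteq[symmetric])
    have sub: "ends G e \<subseteq> verts G" "card (ends G e) = 2" "card (ends G (g e)) = 2"
      using G e Fe(2) by (auto simp: finite_graph_def)
    then show "card (ends G (g e)) \<le> card (f ` ends G e)"
      using card_image[OF inj_on_subset[OF inj(1)]] by simp
    show "finite (ends G (g e))" using sub(3) by (simp add: card_ge_0_finite)
    show "f ` ends G e \<subseteq> ends G (g e)"
    proof
      fix y assume "y \<in> f ` ends G e"
      then obtain v where v: "v \<in> ends G e" "y = f v" by auto
      then have a: "(v, e) \<in> arcs G" using e by (simp add: arcs_def)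
      then have "H (v, e) \<in> arcs G"
        using FH bij_betwE unfolding graph_iso_def eS by blast
      then show "y \<in> ends G (g e)" using H[OF a] v by (simp add: arcs_def)
    qed
  qed
  moreover have "finite (verts G)" "finite (edges G)" using G by (auto simp: finite_graph_def)
  moreover from this have "f ` verts G = verts G" "g ` edges G = edges G"
    by (simp_all add: endo_inj_surj inj image_subsetI Fv(2) Fe(2))
  ultimately have "graph_aut G f g" using inj by (simp add: graph_iso_def bij_betw_def)
  from that[OF this Fv(1) Fe(1) H] show ?thesis .
qed

text \<open>At old vertices, arc-transitivity provides an automorphism taking \<open>x\<close> to
  \<open>y\<close>, and local symmetry at \<open>y\<close> then corrects its action on edges. At new
  vertices, mapping one arc correctly forces the other half edge.\<close>

lemma star_transitive_subdivision:
  assumes G: "finite_graph G" and sym: "locally_fully_symmetric G" and arc: "arc_transitive G"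
    and reg: "regular_graph k G" and k: "k \<ge> 3"
  shows "star_transitive (subdivision G)"
  unfolding star_transitive_iff
proof (intro ballI allI impI)
  let ?S = "subdivision G"
  let ?I = "incident_edges G" and ?J = "incident_edges ?S"
  fix v1 v2 s
  assume v: "v1 \<in> verts ?S" "v2 \<in> verts ?S" and s: "bij_betw s (?J v1) (?J v2)"
  let ?goal = "\<exists>f g. graph_aut ?S f g \<and> f v1 = v2 \<and> (\<forall>e\<in>?J v1. g e = s e)"
  have vk: "card (?I x) = k" if "x \<in> verts G" for x
    using reg that by (simp add: regular_graph_def valency_def)
  have val: "valency ?S v1 = valency ?S v2"
    using bij_betw_same_card[OF s] by (simp add: valency_def)
  have J: "card (?J v2) \<le> 2 \<Longrightarrow> finite (?J v2)"
    using finite_incident_edges[OF finite_graph_subdivision[OF G]] by blast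
  have vS: "verts ?S = verts G <+> edges G" by (simp add: subdivision_def)
  \<comment> \<open>Old vertices have valency \<open>k \<ge> 3\<close> and new ones valency two,
    while \<open>s\<close> forces equal valencies; so the two kinds never mix.\<close>
  consider x y where "v1 = Inl x" "v2 = Inl y" "x \<in> verts G" "y \<in> verts G"
    | d e where "v1 = Inr d" "v2 = Inr e" "d \<in> edges G" "e \<in> edges G"
    using v val k reg valency_subdivision(2)[OF G]
    by (auto simp: vS valency_subdivision(1) regular_graph_def)
  then show ?goal
  proof cases
    case (1 x y)
    define t where "t e = snd (s (x, e))" for e
    have st: "s (x, e) = (y, t e)" if "e \<in> ?I x" for e
    proof -
      have "s (x, e) \<in> Pair y ` ?I y"
        using bij_betwE[OF s] that unfolding 1(1,2) incident_edges_subdivision(1) by blast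
      then show ?thesis by (auto simp: t_def)
    qed
    have "bij_betw (snd \<circ> (s \<circ> Pair x)) (?I x) (?I y)"
      using s 1
      by (intro bij_betw_trans[OF bij_betw_trans[of "Pair x" _ "?J v1"]])
        (auto simp: incident_edges_subdivision bij_betw_def inj_on_def image_image)
    then have t: "bij_betw t (?I x) (?I y)" by (simp add: t_def[abs_def] comp_def)
    have "?I x \<noteq> {}" "?I y \<noteq> {}" using vk 1 k by fastforce+
    then obtain d e where "(x, d) \<in> arcs G" "(y, e) \<in> arcs G"
      by (auto simp: incident_edges_def arcs_def)
    then obtain f g where fg: "graph_aut G f g" "f x = y"
      using arc unfolding arc_transitive_def by fastforce
    have g: "bij_betw g (?I x) (?I y)"
      using graph_iso_incident_edges[OF G fg(1) 1(3)] fg(2) by simp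
    \<comment> \<open>The correction at \<open>y\<close>: undo \<open>g\<close>, then apply
      \<open>t\<close>. Outside the star it is the identity, as \<open>permutes\<close>
      demands.\<close>
    define p where "p e = (if e \<in> ?I y then t (inv_into (?I x) g e) else e)" for e
    have "bij_betw (t \<circ> inv_into (?I x) g) (?I y) (?I y)"
      by (rule bij_betw_trans[OF bij_betw_inv_into[OF g] t])
    then have "bij_betw p (?I y) (?I y)"
      by (rule bij_betw_cong[THEN iffD1, rotated]) (simp add: p_def)
    then have "p permutes ?I y" by (rule bij_imp_permutes) (simp add: p_def)
    then obtain f' g' where fg': "graph_aut G f' g'" "f' y = y" "\<And>e. e \<in> ?I y \<Longrightarrow> g' e = p e"
      using sym 1(4) unfolding locally_fully_symmetric_def by blast
    have aut: "graph_aut ?S (map_sum (f' \<circ> f) (g' \<circ> g)) (map_prod (f' \<circ> f) (g' \<circ> g))"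
      by (intro subdivision_aut[OF G] graph_iso_compose[OF fg(1) fg'(1)])
    have "g' (g e) = t e" if "e \<in> ?I x" for e
    proof -
      have "g e \<in> ?I y" "inv_into (?I x) g (g e) = e"
        using that g by (auto simp: bij_betw_def)
      then show ?thesis using fg'(3) by (simp add: p_def)
    qed
    then have "\<forall>a\<in>?J v1. map_prod (f' \<circ> f) (g' \<circ> g) a = s a"
      using 1 st fg(2) fg'(2) by (auto simp: incident_edges_subdivision)
    moreover have "map_sum (f' \<circ> f) (g' \<circ> g) v1 = v2" using 1 fg fg' by simp
    ultimately show ?thesis using aut by blast
  next
    case (2 d e)
    obtain u where u: "u \<in> ends G d"
      using finite_graph_edge[OF G 2(3)] by blast
    then have a: "(u, d) \<in> ?J v1" using 2 by (simp add: incident_edges_subdivision)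
    then have "s (u, d) \<in> ?J v2" using bij_betwE[OF s] by blast
    then obtain w where w: "s (u, d) = (w, e)" "w \<in> ends G e"
      using 2 by (auto simp: incident_edges_subdivision)
    have "(u, d) \<in> arcs G" "(w, e) \<in> arcs G" using u w 2 by (auto simp: arcs_def)
    then obtain f g where fg: "graph_aut G f g" "f u = w" "g d = e"
      using arc unfolding arc_transitive_def by fastforce
    have aut: "graph_aut ?S (map_sum f g) (map_prod f g)"
      by (rule subdivision_aut[OF G fg(1)])
    have "map_sum f g v1 = v2" using 2 fg by simp
    moreover from this have "bij_betw (map_prod f g) (?J v1) (?J v2)"
      using graph_iso_incident_edges[OF finite_graph_subdivision[OF G] aut v(1)] by simp
    moreover have "card (?J v2) \<le> 2"
      using valency_subdivision(2)[OF G 2(4)] 2 by (simp add: valency_def)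
    ultimately have "\<forall>b\<in>?J v1. map_prod f g b = s b"
      using bij_betw_eq_if_card_le_2[of "map_prod f g" "?J v1" "?J v2" s "(u, d)"] s J a fg w
      by simp
    then show ?thesis using aut \<open>map_sum f g v1 = v2\<close> by blast
  qed
qed

text \<open>The star of the old vertex \<open>Inl v\<close> copies that of \<open>v\<close>: a
  permutation is lifted there, realised in the subdivision, and the automorphism descends because
  \<open>k \<noteq> 2\<close>. For arcs, regularity gives any two old vertices the valency needed to
  be matched.\<close>

lemma symmetric_if_star_transitive_subdivision:
  assumes G: "finite_graph G" and S: "star_transitive (subdivision G)"
    and reg: "regular_graph k G" and k: "k \<noteq> 2"
  shows "locally_fully_symmetric G" "arc_transitive G"
proof -
  let ?S = "subdivision G"
  let ?I = "incident_edges G"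
  have val: "valency G v \<noteq> 2" if "v \<in> verts G" for v
    using reg k that by (simp add: regular_graph_def)
  have V: "Inl v \<in> verts ?S" if "v \<in> verts G" for v
    using that by (auto simp: subdivision_def)
  show "locally_fully_symmetric G"
    unfolding locally_fully_symmetric_def
  proof (intro ballI allI impI)
    fix v p assume v: "v \<in> verts G" and p: "p permutes ?I v"
    have "bij_betw (map_prod id p) (Pair v ` ?I v) (Pair v ` ?I v)"
      using permutes_imp_bij[OF p] by (auto simp: bij_betw_def inj_on_def image_image) 
    then obtain F H where FH: "graph_aut ?S F H" "F (Inl v) = Inl v"
      "\<And>a. a \<in> Pair v ` ?I v \<Longrightarrow> H a = map_prod id p a"
      using star_transitiveD[OF S V[OF v] V[OF v]] by (metis incident_edges_subdivision(1))
    obtain f g where fg: "graph_aut G f g" "\<And>v. v \<in> verts G \<Longrightarrow> F (Inl v) = Inl (f v)"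
      "\<And>v e. (v, e) \<in> arcs G \<Longrightarrow> H (v, e) = (f v, g e)"
      using subdivision_aut_descends[OF G FH(1) val] by metis
    have "g e = p e" if "e \<in> ?I v" for e
    proof -
      have "(v, e) \<in> arcs G" using that by (simp add: arcs_def incident_edges_def)
      then show ?thesis using fg(3)[of v e] FH(3)[of "(v, e)"] that by simp
    qed
    moreover have "f v = v" using fg(2)[OF v] FH(2) by simp
    ultimately show "\<exists>f g. graph_aut G f g \<and> f v = v \<and> (\<forall>e\<in>?I v. g e = p e)"
      using fg(1) by blast
  qed
  show "arc_transitive G"
    unfolding arc_transitive_def
  proof (intro ballI)
    fix a b assume ab: "a \<in> arcs G" "b \<in> arcs G"
    obtain u d w e where uw: "a = (u, d)" "b = (w, e)" by (cases a, cases b)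
    have m: "u \<in> verts G" "w \<in> verts G" "d \<in> ?I u" "e \<in> ?I w"
      using ab uw G by (auto simp: arcs_def finite_graph_def incident_edges_def)
    have vals: "valency ?S (Inl u) = valency ?S (Inl w)"
      using reg m by (simp add: valency_subdivision regular_graph_def)
    have "a \<in> incident_edges ?S (Inl u)" "b \<in> incident_edges ?S (Inl w)"
      using m uw by (auto simp: incident_edges_subdivision)
    from star_transitive_arcs[OF finite_graph_subdivision[OF G] S V[OF m(1)] V[OF m(2)] vals this]
    obtain F H where FH: "graph_aut ?S F H" "F (Inl u) = Inl w" "H a = b" .
    obtain f g where fg: "graph_aut G f g" 
      "\<And>v e. (v, e) \<in> arcs G \<Longrightarrow> H (v, e) = (f v, g e)"
      using subdivision_aut_descends[OF G FH(1) val] by metis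
    have "map_prod f g a = b" using fg(2)[of u d] ab FH(3) uw by simp
    then show "\<exists>f g. graph_aut G f g \<and> map_prod f g a = b" using fg(1) by blast
  qed
qed

text \<open>\<open>\<Sigma>\<close> has the vertices of valency \<open>k\<close> as vertices and
  those of valency two as edges, each joining its two neighbours. The coding \<open>enc\<close>
  moves both into \<open>nat\<close>, the type over which the classification quantifies.\<close>

lemma isomorphic_subdivision:
  assumes L: "finite_graph L" "simple_graph L" and k: "k \<noteq> 2"
    and val: "\<And>x. x \<in> verts L \<Longrightarrow> valency L x = 2 \<or> valency L x = k"
    and ends: "\<And>h. h \<in> edges L \<Longrightarrow> \<exists>x y. ends L h = {x, y} \<and> valency L x = k \<and> valency L y = 2"
  shows "\<exists>\<Sigma> :: (nat, nat) graph.
    finite_graph \<Sigma> \<and> regular_graph k \<Sigma> \<and> isomorphic L (subdivision \<Sigma>)"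
proof -
  define A where "A = {x \<in> verts L. valency L x = k}"
  define B where "B = {x \<in> verts L. valency L x = 2}"
  have fin: "finite (verts L)" using L(1) by (simp add: finite_graph_def)
  then obtain enc :: "'a \<Rightarrow> nat" where enc: "inj_on enc (verts L)"
    using finite_imp_inj_to_nat_seg by blast
  have "\<forall>h. \<exists>x y. h \<in> edges L \<longrightarrow> ends L h = {x, y} \<and> x \<in> A \<and> y \<in> B"
  proof
    fix h
    show "\<exists>x y. h \<in> edges L \<longrightarrow> ends L h = {x, y} \<and> x \<in> A \<and> y \<in> B"
    proof (cases "h \<in> edges L")
      case True
      then have "ends L h \<subseteq> verts L" using L(1) by (simp add: finite_graph_def)
      then show ?thesis using ends[OF True] by (auto simp: A_def B_def)
    qed simp
  qed
  \<comment> \<open>\<open>a h\<close> is the end of \<open>h\<close> that stays a vertex of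
    \<open>\<Sigma>\<close>, and \<open>b h\<close> the end that becomes an edge.\<close>
  then obtain a b where ab: "\<And>h. h \<in> edges L \<Longrightarrow> ends L h = {a h, b h} \<and> a h \<in> A \<and> b h \<in> B"
    by metis
  have AB: "A \<inter> B = {}" "A \<subseteq> verts L" "B \<subseteq> verts L" "verts L = A \<union> B"
    using k val by (auto simp: A_def B_def)
  let ?N = "\<lambda>y. {x. adjacent L y x}"
  have N: "x \<in> ?N y \<longleftrightarrow> (\<exists>h\<in>edges L. a h = x \<and> b h = y)" if "y \<in> B" for x y
  proof
    assume "x \<in> ?N y"
    then obtain h where h: "h \<in> edges L" "ends L h = {y, x}" by (auto simp: adjacent_def)
    then have "{a h, b h} = {y, x}" "a h \<noteq> y" using ab[OF h(1)] that AB by auto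
    then show "\<exists>h\<in>edges L. a h = x \<and> b h = y" using h(1) by (auto simp: doubleton_eq_iff)
  next
    assume "\<exists>h\<in>edges L. a h = x \<and> b h = y"
    then show "x \<in> ?N y" using ab by (auto simp: adjacent_def insert_commute)
  qed
  have NA: "?N y \<subseteq> A" if "y \<in> B" for y
    using N[OF that] ab by auto
  \<comment> \<open>Valency counts edges; simplicity turns the two edges at \<open>y\<close> into
    two distinct neighbours, so no loop arises in \<open>\<Sigma>\<close>.\<close>
  have cardN: "card (?N y) = 2" if "y \<in> B" for y
  proof -
    obtain t where "bij_betw t (?N y) (incident_edges L y)"
      using incident_edges_simple_bij[OF L, of y] by blast
    then show ?thesis using that by (simp add: bij_betw_same_card B_def valency_def)
  qed
  define dec where "dec = inv_into (verts L) enc"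
  have dec: "dec (enc y) = y" if "y \<in> B" for y
    using that enc AB by (auto simp: dec_def)
  define \<Sigma> where "\<Sigma> = \<lparr>verts = enc ` A, edges = enc ` B, ends = (\<lambda>m. enc ` ?N (dec m))\<rparr>"
  have \<Sigma>: "verts \<Sigma> = enc ` A" "edges \<Sigma> = enc ` B" "\<And>y. y \<in> B \<Longrightarrow> ends \<Sigma> (enc y) = enc ` ?N y"
    by (auto simp: \<Sigma>_def dec)
  have enc_eq: "enc x = enc y \<longleftrightarrow> x = y" if "x \<in> verts L" "y \<in> verts L" for x y
    using inj_on_eq_iff[OF enc that] .
  have fin\<Sigma>: "finite_graph \<Sigma>"
    unfolding finite_graph_def
  proof (intro conjI ballI)
    show "finite (verts \<Sigma>)" "finite (edges \<Sigma>)"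
      using fin AB by (auto simp: \<Sigma> intro: finite_subset)
    fix m assume "m \<in> edges \<Sigma>"
    then obtain y where y: "y \<in> B" "m = enc y" by (auto simp: \<Sigma>)
    show "ends \<Sigma> m \<subseteq> verts \<Sigma>" unfolding y(2) \<Sigma>(1) \<Sigma>(3)[OF y(1)] by (intro image_mono NA[OF y(1)])
    have "inj_on enc (?N y)" using NA[OF y(1)] AB(2) by (intro inj_on_subset[OF enc]) auto
    then show "card (ends \<Sigma> m) = 2" using \<Sigma> y cardN by (simp add: card_image)
  qed
  define F where "F x = (if x \<in> A then Inl (enc x) else Inr (enc x))" for x
  \<comment> \<open>An edge of \<open>L\<close> is half of an edge of \<open>\<Sigma>\<close>,
    namely of \<open>b h\<close> on the side of \<open>a h\<close>; simplicity will make this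
    labelling injective.\<close>
  define H where "H h = (enc (a h), enc (b h))" for h
  have iso: "graph_iso L (subdivision \<Sigma>) F H"
    unfolding graph_iso_def
  proof (intro conjI ballI)
    show "bij_betw F (verts L) (verts (subdivision \<Sigma>))"
      unfolding bij_betw_def
    proof
      show "inj_on F (verts L)"
        using enc_eq by (intro inj_onI) (auto simp: F_def split: if_splits)
      have "F ` A = Inl ` enc ` A" "F ` B = Inr ` enc ` B"
        using AB(1) by (auto simp: F_def image_image intro!: image_cong)
      then show "F ` verts L = verts (subdivision \<Sigma>)"
        by (simp add: AB(4) image_Un subdivision_def Plus_def \<Sigma>)
    qed
    have arcs: "arcs \<Sigma> = H ` edges L"
    proof (intro equalityI subsetI)
      fix c assume "c \<in> arcs \<Sigma>"
      then obtain y n where y: "y \<in> B" "c = (n, enc y)" "n \<in> ends \<Sigma> (enc y)"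
        by (auto simp: arcs_def \<Sigma>(2))
      then obtain x where "x \<in> ?N y" "n = enc x" using \<Sigma>(3) by auto
      then show "c \<in> H ` edges L" using N[OF y(1)] y(2) by (auto simp: H_def)
    next
      fix c assume "c \<in> H ` edges L"
      then obtain h where h: "h \<in> edges L" "c = H h" by auto
      then have "b h \<in> B" "a h \<in> ?N (b h)" using ab N by auto
      then show "c \<in> arcs \<Sigma>" using h \<Sigma> by (auto simp: arcs_def H_def)
    qed
    have "inj_on H (edges L)"
    proof (rule inj_onI)
      fix h h' assume h: "h \<in> edges L" "h' \<in> edges L" "H h = H h'"
      have "a h \<in> verts L" "a h' \<in> verts L" "b h \<in> verts L" "b h' \<in> verts L"
        using ab[OF h(1)] ab[OF h(2)] AB(2,3) by auto
      then have "a h = a h'" "b h = b h'" using h(3) enc_eq by (simp_all add: H_def)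
      then have "ends L h = ends L h'" using ab h by simp
      then show "h = h'" using inj_onD[OF L(2)[unfolded simple_graph_def]] h by blast
    qed
    then show "bij_betw H (edges L) (edges (subdivision \<Sigma>))"
      by (simp add: bij_betw_def subdivision_def arcs)
    fix h assume h: "h \<in> edges L"
    then have "b h \<notin> A" "a h \<in> A" using ab AB by auto
    then show "ends (subdivision \<Sigma>) (H h) = F ` ends L h"
      using ab[OF h] by (auto simp: subdivision_def H_def F_def)
  qed
  have "regular_graph k \<Sigma>"
    unfolding regular_graph_def
  proof
    fix m assume "m \<in> verts \<Sigma>"
    then obtain x where x: "x \<in> A" "m = enc x" by (auto simp: \<Sigma>)
    then have "valency (subdivision \<Sigma>) (F x) = k"
      using graph_iso_valency[OF L(1) iso] by (simp add: A_def)
    then show "valency \<Sigma> m = k" using x by (simp add: F_def valency_subdivision(1))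
  qed
  then show ?thesis using fin\<Sigma> iso by (auto simp: isomorphic_def)
qed

subsection \<open>The classification\<close>

theorem theorem1p3:
  fixes L :: "('v, 'e) graph"
  assumes "finite_graph L" and "simple_graph L" and "connected_graph L"
    and "min_valency L = 1 \<or> min_valency L = 2"
  shows "star_transitive L \<and> st_edge_transitive L \<longleftrightarrow>
    (\<exists>n\<ge>1. isomorphic L (complete_bipartite 1 n)) \<or>
    (\<exists>n\<ge>3. isomorphic L (cycle_graph n)) \<or>
    (\<exists>\<Sigma> :: (nat, nat) graph. finite_graph \<Sigma> \<and> locally_fully_symmetric \<Sigma> \<and> arc_transitive \<Sigma> \<and>
       (\<exists>k\<ge>3. regular_graph k \<Sigma>) \<and> isomorphic L (subdivision \<Sigma>))"
    (is "_ \<longleftrightarrow> ?cases")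
proof -
  define d where "d = min_valency L"
  have d: "d = 1 \<or> d = 2" using assms(4) by (simp add: d_def)
  have fin: "finite (valency L ` verts L)" "valency L ` verts L \<noteq> {}"
    using assms(1,3) by (auto simp: finite_graph_def connected_graph_def)
  obtain v where v: "v \<in> verts L" "valency L v = d"
    using Min_in[OF fin] by (auto simp: d_def min_valency_def)
  have dle: "d \<le> valency L x" if "x \<in> verts L" for x
    using Min_le[OF fin(1)] that by (simp add: d_def min_valency_def)
  have "incident_edges L v \<noteq> {}" using v(2) d by (auto simp: valency_def)
  then obtain e where e: "e \<in> edges L" "v \<in> ends L e" by (auto simp: incident_edges_def)
  obtain w where w: "ends L e = {v, w}" "w \<in> verts L"
    using finite_graph_ends[OF assms(1) e] by metis
  define k where "k = valency L w"
  have "d \<le> k" using dle[OF w(2)] by (simp add: k_def)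
  have edge: "\<exists>x y. ends L h = {x, y} \<and> valency L x = d \<and> valency L y = k"
    if "star_transitive L" "h \<in> edges L" for h
    using star_transitive_valencies(2)[OF assms(1,3) that(1) e(1) w(1) that(2)] v(2)
    by (simp add: k_def)
  have vert: "valency L x = d \<or> valency L x = k" if "star_transitive L" "x \<in> verts L" for x
    using star_transitive_valencies(1)[OF assms(1,3) that(1) e(1) w(1) that(2)] v(2)
    by (simp add: k_def)
  have "?cases" if S: "star_transitive L"
  proof -
    consider "d = 1" | "d = 2" "k = 2" | "d = 2" "k \<ge> 3"
      using d \<open>d \<le> k\<close> by linarith
    then show ?thesis
    proof cases
      case 1
      \<comment> \<open>Should \<open>w\<close> be the end named \<open>x\<close>, then
        \<open>w\<close> itself has valency one, and \<open>u\<close>, sharing the valency of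
        \<open>w\<close>, is again a leaf.\<close>
      have "valency L u = 1" if h: "h \<in> edges L" "ends L h = {w, u}" for h u
      proof -
        obtain x y where "{w, u} = {x, y}" "valency L x = 1" "valency L y = valency L w"
          using edge[OF S h(1)] h(2) 1 by (auto simp: k_def)
        then show ?thesis by (auto simp: doubleton_eq_iff)
      qed
      then have "isomorphic L (complete_bipartite 1 k)"
        using isomorphic_complete_bipartite_1[OF assms(1,3) w(2)] by (simp add: k_def)
      then show ?thesis using \<open>d \<le> k\<close> 1 by blast
    next
      case 2
      then have "regular_graph 2 L" using vert[OF S] by (auto simp: regular_graph_def)
      then show ?thesis using isomorphic_cycle_graph[OF assms(1-3) S] by blast
    next
      case 3
      have "\<exists>x y. ends L h = {x, y} \<and> valency L x = k \<and> valency L y = 2" if h: "h \<in> edges L" for h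
        using edge[OF S h] 3(1) by (metis insert_commute)
      moreover have "k \<noteq> 2" using 3(2) by simp
      ultimately obtain \<Sigma> :: "(nat, nat) graph"
        where \<Sigma>: "finite_graph \<Sigma>" "regular_graph k \<Sigma>" "isomorphic L (subdivision \<Sigma>)"
        using isomorphic_subdivision[OF assms(1,2), of k] vert[OF S] 3(1) by blast
      have "isomorphic (subdivision \<Sigma>) L" using isomorphic_sym[OF assms(1) \<Sigma>(3)] .
      then have "star_transitive (subdivision \<Sigma>)"
        using star_transitive_iso[OF finite_graph_subdivision[OF \<Sigma>(1)] _ S]
        unfolding isomorphic_def by blast
      then have "locally_fully_symmetric \<Sigma>" "arc_transitive \<Sigma>"
        using symmetric_if_star_transitive_subdivision[OF \<Sigma>(1) _ \<Sigma>(2) \<open>k \<noteq> 2\<close>] by blast+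
      then show ?thesis using \<Sigma> 3(2) by blast
    qed
  qed
  \<comment> \<open>Only star-transitivity is transported from the three models; edge stars are
    handled in \<open>L\<close> itself.\<close>
  moreover have "star_transitive L" if ?cases
    using that star_transitive_iso[OF assms(1)] star_transitive_complete_bipartite_1
      star_transitive_cycle_graph star_transitive_subdivision
    unfolding isomorphic_def by metis
  \<comment> \<open>Every edge has an end of the minimal valency \<open>d \<le> 2\<close>, as
    required for passing from stars to edge stars.\<close>
  moreover have "st_edge_transitive L" if S: "star_transitive L"
  proof (rule st_edge_transitive_if_star_transitive[OF assms(1,2) S])
    fix h assume "h \<in> edges L"
    then obtain x y where "ends L h = {x, y}" "valency L x = d" using edge[OF S] by blast
    moreover have "d \<le> 2" using d by auto
    ultimately show "\<exists>v\<in>ends L h. valency L v \<le> 2" by auto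
  qed
  ultimately show ?thesis by blast
qed

end
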